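(* For any $\mathcal{A} \in \mathbb{R}^{m \times n \times p}$, the tensor $\mathcal{A}_1$ is a best T-rank one approximation of $\mathcal{A}$; that is, $\mathcal{A}_1$ has T-rank at most one and $\|\mathcal{A}-\mathcal{A}_1\|_F \le \|\mathcal{A}-\mathcal{B}\|_F$ for every $\mathcal{B}\in\mathbb{R}^{m\times n\times p}$ of T-rank at most one.
   Context: For a third order tensor $\mathcal{A} = (a_{ijk}) \in \mathbb{R}^{m\times n\times p}$, let $A^{(k)} = (a_{ijk})_{i,j} \in \mathbb{R}^{m\times n}$, $k=1,\dots,p$, be its frontal slices, and $\|\mathcal{A}\|_F=\sqrt{\sum_{i,j,k}|a_{ijk}|^2}$. $\mathrm{bcirc}(\mathcal{A}) \in \mathbb{R}^{mp\times np}$ is the block circulant matrix whose $(s,t)$ block is $A^{(r)}$ with $r \in \{1,\dots,p\}$, $r \equiv s-t+1 \pmod p$ (first block column $A^{(1)},A^{(2)},\dots,A^{(p)}$); $\mathrm{bcirc}^{-1}$ is its inverse, defined on block circulant matrices. T-product: for $\mathcal{A}\in\mathbb{R}^{m\times s\times p}$, $\mathcal{B}\in\mathbb{R}^{s\times n\times p}$, $\mathcal{A}*\mathcal{B} := \mathrm{bcirc}^{-1}(\mathrm{bcirc}(\mathcal{A})\,\mathrm{bcirc}(\mathcal{B})) \in \mathbb{R}^{m\times n\times p}$. Transpose: $\mathcal{A}^\top := \mathrm{bcirc}^{-1}(\mathrm{bcirc}(\mathcal{A})^\top)$. Identity tensor: $\mathcal{I}_{nnp} := \mathrm{bcirc}^{-1}(I_{np})$.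 A tensor $\mathcal{Q}\in\mathbb{R}^{n\times n\times p}$ is orthogonal if $\mathcal{Q}*\mathcal{Q}^\top=\mathcal{Q}^\top*\mathcal{Q}=\mathcal{I}_{nnp}$. Kilmer-Martin mapping: put $\omega=e^{-2\pi\sqrt{-1}/p}$ and $\Delta^{(k)}=\sum_{l=1}^p \omega^{(k-1)(l-1)}A^{(l)}\in\mathbb{C}^{m\times n}$ for $k=1,\dots,p$. Let $\Sigma(1,1,k)\ge\Sigma(2,2,k)\ge\cdots\ge\Sigma(\min\{m,n\},\min\{m,n\},k)\ge 0$ be the singular values of the matrix $\Delta^{(k)}$ in non-increasing order. Then $\mathcal{S}=\mathcal{S}(\mathcal{A})\in\mathbb{R}^{m\times n\times p}$ is the (real) tensor all of whose frontal slices are diagonal, with diagonal entries $\mathcal{S}(i,i,k)=\frac1p\sum_{l=1}^p\bar\omega^{(k-1)(l-1)}\Sigma(i,i,l)$ for $1\le i\le\min\{m,n\}$, $1\le k\le p$. Kilmer-Martin T-SVD: a factorization $\mathcal{A}=\mathcal{U}*\mathcal{S}(\mathcal{A})*\mathcal{V}^\top$ with orthogonal tensors $\mathcal{U}\in\mathbb{R}^{m\times m\times p}$, $\mathcal{V}\in\mathbb{R}^{n\times n\times p}$; such a factorization always exists (it is obtained from SVDs $\Delta^{(k)}=\Phi^{(k)}\Sigma^{(k)}(\Psi^{(k)})^*$ by applying the inverse discrete Fourier transform along the third mode to $(\Phi^{(k)})_k$ and $(\Psi^{(k)})_k$, the SVDs being chosen so that the results are real). The singular values of $\mathcal{A}$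 are the absolute values $|\mathcal{S}(i,i,k)|$, $1\le i\le\min\{m,n\}$, $1\le k\le p$; $\sigma_1(\mathcal{A})$ denotes the largest of them. The T-rank of $\mathcal{A}$ is the number of nonzero singular values, i.e. the number of pairs $(i,k)$ with $\mathcal{S}(i,i,k)\neq0$. Let $\mathcal{S}_1\in\mathbb{R}^{m\times n\times p}$ be the tensor that agrees with $\mathcal{S}=\mathcal{S}(\mathcal{A})$ at a diagonal position $(i,i,k)$ where $\sigma_1(\mathcal{A})$ is located (i.e. $|\mathcal{S}(i,i,k)|=\sigma_1(\mathcal{A})$) and is zero elsewhere, and let $\mathcal{A}_1:=\mathcal{U}*\mathcal{S}_1*\mathcal{V}^\top$, where $\mathcal{A}=\mathcal{U}*\mathcal{S}*\mathcal{V}^\top$ is a Kilmer-Martin T-SVD. *)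

theory Defs
  imports
    Complex_Main
    "HOL-Computational_Algebra.Fundamental_Theorem_Algebra"
    "Jordan_Normal_Form.Char_Poly"
    "Jordan_Normal_Form.Schur_Decomposition"
begin

text \<open>
  A third order tensor of size \<open>m \<times> n \<times> p\<close> is represented by the list of its \<open>p\<close> frontal slices.
  All indices start at \<open>0\<close>: in 1-based notation the entry \<open>a\<^sub>i\<^sub>j\<^sub>k\<close> is \<open>A ! (k - 1) $$ (i - 1, j - 1)\<close>.
\<close>

type_synonym tensor = "real mat list"

definition carrier_tensor :: "nat \<Rightarrow> nat \<Rightarrow> nat \<Rightarrow> tensor set" where
  "carrier_tensor m n p = {A. length A = p \<and> set A \<subseteq> carrier_mat m n}"

text \<open>For \<open>p > 0\<close> the size can be read off from a tensor: all slices have the size of the first.\<close>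

definition t_rows :: "tensor \<Rightarrow> nat" where
  "t_rows A = dim_row (hd A)"

definition t_cols :: "tensor \<Rightarrow> nat" where
  "t_cols A = dim_col (hd A)"

definition t_minus :: "tensor \<Rightarrow> tensor \<Rightarrow> tensor" where
  "t_minus A B = map2 (-) A B"

definition frob_norm :: "tensor \<Rightarrow> real" where
  "frob_norm A = sqrt (\<Sum>k<length A. \<Sum>i<t_rows A. \<Sum>j<t_cols A. \<bar>A ! k $$ (i, j)\<bar>\<^sup>2)"

text \<open>
  Row \<open>i\<close> lies in the block row \<open>i div m\<close>, column \<open>j\<close> in the block column \<open>j div n\<close>; the summand \<open>p\<close>
  keeps the natural number subtraction from truncating.
\<close>

definition bcirc :: "tensor \<Rightarrow> real mat" where
  "bcirc A = (let m = t_rows A; n = t_cols A; p = length A in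
     mat (m * p) (n * p)
       (\<lambda>(i, j). A ! ((i div m + p - j div n) mod p) $$ (i mod m, j mod n)))"

text \<open>
  Only meaningful on block circulant matrices, that is on the image of \<^const>\<open>bcirc\<close>; see
  \<open>bcirc_inv_bcirc\<close>, \<open>bcirc_t_prod\<close>, \<open>bcirc_t_transpose\<close> and \<open>bcirc_t_id\<close> below.
\<close>

definition bcirc_inv :: "nat \<Rightarrow> nat \<Rightarrow> nat \<Rightarrow> real mat \<Rightarrow> tensor" where
  "bcirc_inv m n p = inv_into (carrier_tensor m n p) bcirc"

definition t_prod :: "tensor \<Rightarrow> tensor \<Rightarrow> tensor" (infixl "*\<^sub>T" 70) where
  "A *\<^sub>T B = bcirc_inv (t_rows A) (t_cols B) (length A) (bcirc A * bcirc B)"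

definition t_transpose :: "tensor \<Rightarrow> tensor" where
  "t_transpose A = bcirc_inv (t_cols A) (t_rows A) (length A) (transpose_mat (bcirc A))"

definition t_id :: "nat \<Rightarrow> nat \<Rightarrow> tensor" where
  "t_id n p = bcirc_inv n n p (1\<^sub>m (n * p))"

definition t_orthogonal :: "nat \<Rightarrow> nat \<Rightarrow> tensor \<Rightarrow> bool" where
  "t_orthogonal n p Q \<longleftrightarrow>
     Q \<in> carrier_tensor n n p \<and> Q *\<^sub>T t_transpose Q = t_id n p \<and> t_transpose Q *\<^sub>T Q = t_id n p"

definition dft_slice :: "tensor \<Rightarrow> nat \<Rightarrow> complex mat" where
  "dft_slice A k = (let p = length A; \<omega> = cis (- 2 * pi / real p) in
     mat (t_rows A) (t_cols A) (\<lambda>(i, j). \<Sum>l<p. \<omega> ^ (k * l) * complex_of_real (A ! l $$ (i, j))))"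

text \<open>
  The square roots of the eigenvalues of \<open>M\<^sup>* M\<close>, with multiplicity and in non-increasing order. There
  are \<open>dim_col M\<close> of them; those with index below \<open>min (dim_row M) (dim_col M)\<close> are the singular
  values of \<open>M\<close>, the remaining ones are zero.
\<close>

definition singular_values :: "complex mat \<Rightarrow> real list" where
  "singular_values M = rev (sorted_list_of_multiset
     (image_mset (\<lambda>z. sqrt (Re z)) (proots (char_poly (mat_adjoint M * M)))))"

text \<open>
  The numbers below are real (see \<open>KM_coeff_real\<close>), so taking the real part is a mere change of type.
\<close>

definition KM_coeff :: "tensor \<Rightarrow> nat \<Rightarrow> nat \<Rightarrow> complex" where
  "KM_coeff A i k = (let p = length A; \<omega> = cis (- 2 * pi / real p) in
     (1 / of_nat p) *
       (\<Sum>l<p. cnj \<omega> ^ (k * l) * complex_of_real (singular_values (dft_slice A l) ! i)))"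

definition KM_S :: "tensor \<Rightarrow> tensor" where
  "KM_S A = map (\<lambda>k. mat (t_rows A) (t_cols A)
     (\<lambda>(i, j). if i = j then Re (KM_coeff A i k) else 0)) [0..<length A]"

definition is_KM_TSVD :: "tensor \<Rightarrow> tensor \<Rightarrow> tensor \<Rightarrow> bool" where
  "is_KM_TSVD A U V \<longleftrightarrow>
     t_orthogonal (t_rows A) (length A) U \<and> t_orthogonal (t_cols A) (length A) V \<and>
     A = U *\<^sub>T KM_S A *\<^sub>T t_transpose V"

definition diag_positions :: "tensor \<Rightarrow> (nat \<times> nat) set" where
  "diag_positions A = {..<min (t_rows A) (t_cols A)} \<times> {..<length A}"

definition t_singular_value :: "tensor \<Rightarrow> nat \<times> nat \<Rightarrow> real" where
  "t_singular_value A = (\<lambda>(i, k). \<bar>KM_S A ! k $$ (i, i)\<bar>)"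

definition \<sigma>\<^sub>1 :: "tensor \<Rightarrow> real" where
  "\<sigma>\<^sub>1 A = Max (t_singular_value A ` diag_positions A)"

definition T_rank :: "tensor \<Rightarrow> nat" where
  "T_rank A = card {x \<in> diag_positions A. t_singular_value A x \<noteq> 0}"

definition keep_diag :: "tensor \<Rightarrow> nat \<times> nat \<Rightarrow> tensor" where
  "keep_diag S x = map (\<lambda>l. mat (t_rows S) (t_cols S)
     (\<lambda>(i, j). if i = fst x \<and> j = fst x \<and> l = snd x then S ! l $$ (i, j) else 0)) [0..<length S]"


subsection \<open>Well-definedness\<close>

lemma carrier_tensorD:
  assumes "A \<in> carrier_tensor m n p" "0 < p"
  shows "length A = p" "t_rows A = m" "t_cols A = n" "\<And>k. k < p \<Longrightarrow> A ! k \<in> carrier_mat m n"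
proof -
  show l: "length A = p" using assms by (simp add: carrier_tensor_def)
  show c: "\<And>k. k < p \<Longrightarrow> A ! k \<in> carrier_mat m n"
    using assms l by (auto simp: carrier_tensor_def)
  have "hd A = A ! 0" using l assms(2) by (cases A) auto
  then show "t_rows A = m" "t_cols A = n"
    using c[of 0] assms by (auto simp: t_rows_def t_cols_def)
qed

lemma bcirc_carrier [simp]:
  assumes "A \<in> carrier_tensor m n p" "0 < p"
  shows "bcirc A \<in> carrier_mat (m * p) (n * p)"
  using carrier_tensorD[OF assms] by (simp add: bcirc_def Let_def)

lemma block_index: "a < m \<Longrightarrow> s < p \<Longrightarrow> s * m + a < m * (p::nat)"
  by (metis mult.commute mult_Suc less_le_trans Suc_leI mult_le_mono2 add.commute
      nat_add_left_cancel_less)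

lemma bcirc_block:
  assumes A: "A \<in> carrier_tensor m n p" and "a < m" "b < n" "s < p" "t < p"
  shows "bcirc A $$ (s * m + a, t * n + b) = A ! ((s + p - t) mod p) $$ (a, b)"
proof -
  have "0 < p" using assms by simp
  note D = carrier_tensorD[OF A this]
  show ?thesis
    using assms block_index[of a m s p] block_index[of b n t p]
    by (simp add: bcirc_def Let_def D)
qed

lemma block_decomp:
  assumes "i < m * (p::nat)"
  obtains s a where "i = s * m + a" "a < m" "s < p"
proof -
  have "0 < m" using assms by (cases m) auto
  then show thesis
    using that[of "i div m" "i mod m"] assms
    by (simp add: less_mult_imp_div_less mult.commute)
qed

lemma bcirc_inj: "0 < p \<Longrightarrow> inj_on bcirc (carrier_tensor m n p)"
proof (rule inj_onI)
  fix A B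
  assume p: "0 < p" and A: "A \<in> carrier_tensor m n p" and B: "B \<in> carrier_tensor m n p"
    and eq: "bcirc A = bcirc B"
  note DA = carrier_tensorD[OF A p] and DB = carrier_tensorD[OF B p]
  show "A = B"
  proof (rule nth_equalityI)
    show "length A = length B" using DA DB by simp
    fix k assume "k < length A"
    then have k: "k < p" using DA by simp
    show "A ! k = B ! k"
    proof (rule eq_matI)
      fix i j assume "i < dim_row (B ! k)" "j < dim_col (B ! k)"
      then have ij: "i < m" "j < n" using DB(4)[OF k] by auto
      show "A ! k $$ (i, j) = B ! k $$ (i, j)"
        using bcirc_block[OF A ij k p] bcirc_block[OF B ij k p] eq k by simp
    qed (use DA(4)[OF k] DB(4)[OF k] in auto)
  qed
qed

lemma bcirc_inv_bcirc:
  "A \<in> carrier_tensor m n p \<Longrightarrow> 0 < p \<Longrightarrow> bcirc_inv m n p (bcirc A) = A"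
  by (simp add: bcirc_inv_def bcirc_inj)

text \<open>Block circulant matrices are those invariant under a simultaneous cyclic shift of the blocks.\<close>

lemma block_circulant_in_image:
  assumes p: "0 < p" and M: "M \<in> carrier_mat (m * p) (n * p)"
    and shift: "\<And>s t a b. s < p \<Longrightarrow> t < p \<Longrightarrow> a < m \<Longrightarrow> b < n \<Longrightarrow>
      M $$ (s * m + a, t * n + b) = M $$ (((s + p - t) mod p) * m + a, b)"
  shows "M \<in> bcirc ` carrier_tensor m n p"
proof -
  define A where "A = map (\<lambda>k. mat m n (\<lambda>(a, b). M $$ (k * m + a, b))) [0..<p]"
  have A: "A \<in> carrier_tensor m n p" by (auto simp: A_def carrier_tensor_def)
  have "bcirc A = M"
  proof (rule eq_matI)
    fix i j assume "i < dim_row M" "j < dim_col M"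
    then have ij: "i < m * p" "j < n * p" using M by auto
    obtain s a where s: "i = s * m + a" "a < m" "s < p" using block_decomp[OF ij(1)] .
    obtain t b where t: "j = t * n + b" "b < n" "t < p" using block_decomp[OF ij(2)] .
    show "bcirc A $$ (i, j) = M $$ (i, j)"
      using bcirc_block[OF A s(2) t(2) s(3) t(3)] shift[OF s(3) t(3) s(2) t(2)] s t p
      by (simp add: A_def)
  qed (use M bcirc_carrier[OF A p] in auto)
  then show ?thesis using A by blast
qed

lemma bcirc_inv_image:
  assumes "M \<in> bcirc ` carrier_tensor m n p"
  shows "bcirc (bcirc_inv m n p M) = M" "bcirc_inv m n p M \<in> carrier_tensor m n p"
  using assms by (simp_all add: bcirc_inv_def f_inv_into_f inv_into_into)

lemma sum_blocks:
  fixes f :: "nat \<Rightarrow> real"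
  shows "(\<Sum>c<q * p. f c) = (\<Sum>r<p. \<Sum>c<q. f (r * q + c))"
proof (induction p)
  case (Suc p)
  have "{..<q * Suc p} = {..<q * p} \<union> {q * p..<q * p + q}" by (auto simp: add.commute)
  then have "(\<Sum>c<q * Suc p. f c) = (\<Sum>c<q * p. f c) + (\<Sum>c = q * p..<q * p + q. f c)"
    by (simp add: sum.union_disjoint ivl_disj_int)
  also have "(\<Sum>c = q * p..<q * p + q. f c) = (\<Sum>c<q. f (p * q + c))"
    using sum.shift_bounds_nat_ivl[of f 0 "q * p" q]
    by (simp add: lessThan_atLeast0 add.commute mult.commute)
  finally show ?case using Suc by simp
qed simp

lemma mod_shift_bij:
  assumes "t < (p::nat)"
  shows "bij_betw (\<lambda>r. (r + p - t) mod p) {..<p} {..<p}"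
proof -
  have inj: "inj_on (\<lambda>r. (r + p - t) mod p) {..<p}"
  proof (rule inj_onI)
    fix x y assume xy: "x \<in> {..<p}" "y \<in> {..<p}" "(x + p - t) mod p = (y + p - t) mod p"
    have "int ((x + p - t) mod p) = (int x - int t) mod int p" if "x < p" for x
      using that assms by (simp add: of_nat_mod of_nat_diff) (metis add_diff_eq mod_add_self2
        add.commute diff_add_eq)
    from this[of x] this[of y] xy
    have "(int x - int t) mod int p = (int y - int t) mod int p" by (metis lessThan_iff)
    then have "int x mod int p = int y mod int p" by (metis diff_add_cancel mod_add_cong)
    then show "x = y" using xy by simp
  qed
  have "(\<lambda>r. (r + p - t) mod p) ` {..<p} \<subseteq> {..<p}" using assms by auto
  with inj show ?thesis
    by (simp add: bij_betw_def endo_inj_surj)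
qed

lemma mod_shift_diff:
  assumes "s < p" "t < p" "r < (p::nat)"
  shows "((s + p - t) mod p + p - (r + p - t) mod p) mod p = (s + p - r) mod p"
proof -
  have *: "int ((x + p - y) mod p) = (int x - int y) mod int p" if "y < p" for x y
    using that by (simp add: of_nat_mod of_nat_diff) (metis add_diff_eq mod_add_self2
        add.commute diff_add_eq)
  have "(r + p - t) mod p < p" using assms by simp
  from *[OF this] have "int (((s + p - t) mod p + p - (r + p - t) mod p) mod p)
      = ((int s - int t) mod int p - (int r - int t) mod int p) mod int p"
    using *[OF assms(2)] by simp
  also have "\<dots> = (int s - int r) mod int p" by (simp add: mod_diff_eq)
  also have "\<dots> = int ((s + p - r) mod p)" using *[OF assms(3)] by simp
  finally show ?thesis by simp
qed

lemma bcirc_mult_image: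
  assumes p: "0 < p" and A: "A \<in> carrier_tensor m q p" and B: "B \<in> carrier_tensor q n p"
  shows "bcirc A * bcirc B \<in> bcirc ` carrier_tensor m n p"
proof (rule block_circulant_in_image[OF p])
  note cA = bcirc_carrier[OF A p] and cB = bcirc_carrier[OF B p]
  show "bcirc A * bcirc B \<in> carrier_mat (m * p) (n * p)" using cA cB by simp
  fix s t a b assume st: "s < p" "t < p" and ab: "a < m" "b < n"
  have ent: "(bcirc A * bcirc B) $$ (s * m + a, t * n + b) =
      (\<Sum>r<p. \<Sum>c<q. A ! ((s + p - r) mod p) $$ (a, c) * B ! ((r + p - t) mod p) $$ (c, b))"
    if "s < p" "t < p" for s t
  proof -
    have "(bcirc A * bcirc B) $$ (s * m + a, t * n + b) =
        (\<Sum>c<q * p. bcirc A $$ (s * m + a, c) * bcirc B $$ (c, t * n + b))"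
      using that ab cA cB block_index[of a m s p] block_index[of b n t p]
      by (simp add: scalar_prod_def lessThan_atLeast0)
    also have "\<dots> = (\<Sum>r<p. \<Sum>c<q.
        bcirc A $$ (s * m + a, r * q + c) * bcirc B $$ (r * q + c, t * n + b))"
      by (rule sum_blocks)
    also have "\<dots> = (\<Sum>r<p. \<Sum>c<q.
        A ! ((s + p - r) mod p) $$ (a, c) * B ! ((r + p - t) mod p) $$ (c, b))"
      using that ab by (intro sum.cong refl) (simp add: bcirc_block[OF A] bcirc_block[OF B])
    finally show ?thesis .
  qed
  let ?g = "\<lambda>r. \<Sum>c<q. A ! (((s + p - t) mod p + p - r) mod p) $$ (a, c) * B ! ((r + p - 0) mod p) $$ (c, b)"
  have "(bcirc A * bcirc B) $$ (s * m + a, t * n + b) = (\<Sum>r<p. ?g ((r + p - t) mod p))"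
    unfolding ent[OF st] using st
    by (intro sum.cong refl) (simp add: mod_shift_diff)
  also have "\<dots> = (\<Sum>r<p. ?g r)"
    by (rule sum.reindex_bij_betw[OF mod_shift_bij[OF st(2)]])
  also have "\<dots> = (bcirc A * bcirc B) $$ (((s + p - t) mod p) * m + a, b)"
    using ent[of "(s + p - t) mod p" 0] p by simp
  finally show "(bcirc A * bcirc B) $$ (s * m + a, t * n + b)
      = (bcirc A * bcirc B) $$ (((s + p - t) mod p) * m + a, b)" .
qed

lemma bcirc_t_prod:
  assumes "0 < p" "A \<in> carrier_tensor m q p" "B \<in> carrier_tensor q n p"
  shows "bcirc (A *\<^sub>T B) = bcirc A * bcirc B" "A *\<^sub>T B \<in> carrier_tensor m n p"
  using bcirc_inv_image[OF bcirc_mult_image[OF assms]]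
    carrier_tensorD[OF assms(2,1)] carrier_tensorD[OF assms(3,1)]
  by (simp_all add: t_prod_def)

lemma bcirc_t_transpose:
  assumes p: "0 < p" and A: "A \<in> carrier_tensor m n p"
  shows "bcirc (t_transpose A) = transpose_mat (bcirc A)" "t_transpose A \<in> carrier_tensor n m p"
proof -
  note cA = bcirc_carrier[OF A p]
  have "transpose_mat (bcirc A) \<in> bcirc ` carrier_tensor n m p"
  proof (rule block_circulant_in_image[OF p])
    show "transpose_mat (bcirc A) \<in> carrier_mat (n * p) (m * p)" using cA by simp
    fix s t a b assume st: "s < p" "t < p" and ab: "a < n" "b < m"
    have ent: "transpose_mat (bcirc A) $$ (s * n + a, t * m + b) = A ! ((t + p - s) mod p) $$ (b, a)"
      if "s < p" "t < p" for s t
      using that ab cA block_index[of a n s p] block_index[of b m t p] bcirc_block[OF A ab(2,1)]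
      by simp
    have "(0 + p - (s + p - t) mod p) mod p = (t + p - s) mod p"
      using mod_shift_diff[of t p t s] st by simp
    then show "transpose_mat (bcirc A) $$ (s * n + a, t * m + b) =
        transpose_mat (bcirc A) $$ (((s + p - t) mod p) * n + a, b)"
      using ent[OF st] ent[of "(s + p - t) mod p" 0] p by simp
  qed
  from bcirc_inv_image[OF this] show "bcirc (t_transpose A) = transpose_mat (bcirc A)"
    "t_transpose A \<in> carrier_tensor n m p"
    using carrier_tensorD[OF A p] by (simp_all add: t_transpose_def)
qed

lemma bcirc_t_id:
  assumes p: "0 < p"
  shows "bcirc (t_id n p) = 1\<^sub>m (n * p)" "t_id n p \<in> carrier_tensor n n p"
proof -
  have "1\<^sub>m (n * p) \<in> bcirc ` carrier_tensor n n p"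
  proof (rule block_circulant_in_image[OF p])
    fix s t a b assume st: "s < p" "t < p" and ab: "a < n" "b < n"
    have *: "(s * n + a = t * n + b) = (s = t \<and> a = b)" if "s < p" "t < p" for s t
      using ab by (metis add.commute div_mult_self1 div_less mod_mult_self1 mod_less
        add_left_cancel gr_implies_not0 add_0)
    have "((s + p - t) mod p = 0) = (s = t)"
      using st mod_add_self2[of "s - t" p] by (cases "t \<le> s") (simp_all add: not_le)
    then have "(((s + p - t) mod p) * n + a = 0 * n + b) = (s = t \<and> a = b)"
      using *[of "(s + p - t) mod p" 0] p by simp
    then show "1\<^sub>m (n * p) $$ (s * n + a, t * n + b) =
        1\<^sub>m (n * p) $$ (((s + p - t) mod p) * n + a, b)"
      using st ab p * block_index[of a n s p] block_index[of b n t p]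
        block_index[of a n "(s + p - t) mod p" p] block_index[of b n 0 p]
      by simp
  qed simp
  from bcirc_inv_image[OF this] show "bcirc (t_id n p) = 1\<^sub>m (n * p)"
    "t_id n p \<in> carrier_tensor n n p" by (simp_all add: t_id_def)
qed


lemma dft_slice_cnj:
  assumes l: "l < length A"
  shows "dft_slice A ((length A - l) mod length A) = map_mat cnj (dft_slice A l)"
proof -
  define p \<omega> where "p = length A" and "\<omega> = cis (- 2 * pi / real p)"
  have p: "0 < p" and lp: "l < p" using l by (auto simp: p_def)
  have "\<omega> ^ p = 1"
    using p by (simp add: \<omega>_def DeMoivre) (metis cis_2pi cis_cnj complex_cnj_one)
  then have one: "\<omega> ^ (p * r) = 1" for r by (simp add: power_mult)
  have c: "\<omega> * cnj \<omega> = 1" by (simp add: \<omega>_def complex_norm_square[symmetric])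
  have *: "\<omega> ^ (((p - l) mod p) * r) = cnj \<omega> ^ (l * r)" for r
  proof -
    have "\<omega> ^ (((p - l) mod p) * r) * \<omega> ^ (l * r) = 1"
    proof (cases "l = 0")
      case False
      then have "((p - l) mod p) * r + l * r = p * r"
        using lp by (simp add: add_mult_distrib[symmetric])
      then show ?thesis by (simp add: power_add[symmetric] one)
    qed simp
    moreover have "\<omega> ^ (l * r) * cnj \<omega> ^ (l * r) = 1" by (simp add: power_mult_distrib[symmetric] c)
    ultimately show ?thesis by (metis mult.assoc mult.left_neutral mult.right_neutral)
  qed
  show ?thesis
    unfolding dft_slice_def Let_def p_def[symmetric] \<omega>_def[symmetric]
    by (rule eq_matI) (simp_all add: * )
qed

lemma proots_map_cnj: "proots (map_poly cnj q) = image_mset cnj (proots q)"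
proof (cases "q = 0")
  case False
  interpret cnj: inj_comm_ring_hom cnj by unfold_locales auto
  interpret P: map_poly_inj_comm_ring_hom cnj by unfold_locales
  have prod: "proots (\<Prod>x\<in>#X. [:- x, 1:]) = X" for X :: "complex multiset"
  proof (induction X)
    case (add x X)
    have "(\<Prod>x\<in>#X. [:- x, 1:]) \<noteq> 0" by (auto simp: prod_mset_zero_iff)
    then show ?case using add proots_linear_factor[of "-x" for x] by (simp add: proots_mult del: mult_pCons_left)
  qed simp
  have "q = smult (lead_coeff q) (\<Prod>x\<in>#proots q. [:-x, 1:])"
    by (rule complex_poly_decompose_multiset[symmetric])
  from arg_cong[OF this, of "map_poly cnj"]
  have "map_poly cnj q = smult (cnj (lead_coeff q)) (\<Prod>x\<in>#image_mset cnj (proots q). [:-x, 1:])"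
    by (simp add: P.hom_prod_mset cnj.map_poly_hom_smult image_mset.compositionality o_def)
  then show ?thesis using False prod by simp
qed simp

lemma singular_values_cnj: "singular_values (map_mat cnj M) = singular_values M"
proof -
  interpret cnj: inj_comm_ring_hom cnj by unfold_locales auto
  have M: "M \<in> carrier_mat (dim_row M) (dim_col M)" by simp
  have c: "mat_adjoint M \<in> carrier_mat (dim_col M) (dim_row M)"
    by (rule carrier_matI) (simp_all add: mat_adjoint_def)
  have "mat_adjoint (map_mat cnj M) = map_mat cnj (mat_adjoint M)"
    by (rule eq_matI) (simp_all add: mat_adjoint_def mat_of_rows_index conjugate_complex_def)
  then have *: "mat_adjoint (map_mat cnj M) * map_mat cnj M = map_mat cnj (mat_adjoint M * M)"
    unfolding cnj.mat_hom_mult[OF c M] by (rule arg_cong)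
  have "char_poly (mat_adjoint (map_mat cnj M) * map_mat cnj M)
      = map_poly cnj (char_poly (mat_adjoint M * M))"
    unfolding * by (rule cnj.char_poly_hom[OF mult_carrier_mat[OF c M]])
  then have "image_mset (\<lambda>z. sqrt (Re z)) (proots (char_poly (mat_adjoint (map_mat cnj M) * map_mat cnj M)))
      = image_mset (\<lambda>z. sqrt (Re z)) (proots (char_poly (mat_adjoint M * M)))"
    unfolding proots_map_cnj by (simp only: proots_map_cnj image_mset.compositionality o_def cnj.sel(1))
  then show ?thesis unfolding singular_values_def by (rule arg_cong)
qed

lemma KM_coeff_real: "KM_coeff A i k \<in> \<real>"
proof -
  define p \<omega> where "p = length A" and "\<omega> = cis (- 2 * pi / real p)"
  define s where "s l = complex_of_real (singular_values (dft_slice A l) ! i)" for l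
  have c: "\<omega> * cnj \<omega> = 1" by (simp add: \<omega>_def complex_norm_square[symmetric])
  have "cnj (\<Sum>l<p. cnj \<omega> ^ (k * l) * s l) = (\<Sum>l<p. cnj \<omega> ^ (k * l) * s l)"
  proof (cases "p = 0")
    case False
    then have p: "0 < p" by simp
    have "\<omega> ^ p = 1"
      using p by (simp add: \<omega>_def DeMoivre) (metis cis_2pi cis_cnj complex_cnj_one)
    then have one: "\<omega> ^ (p * r) = 1" for r by (simp add: power_mult)
    let ?h = "\<lambda>l. (p - l) mod p"
    have h: "bij_betw ?h {..<p} {..<p}"
    proof (rule bij_betw_byWitness[where f' = ?h])
      show "\<forall>l\<in>{..<p}. ?h (?h l) = l" "\<forall>l\<in>{..<p}. ?h (?h l) = l"
        by (auto simp: mod_if)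
    qed (use p in auto)
    have *: "cnj \<omega> ^ (k * ?h l) = \<omega> ^ (k * l)" if "l < p" for l
    proof -
      have "\<omega> ^ (k * ?h l) * \<omega> ^ (k * l) = 1"
      proof (cases "l = 0")
        case False
        then have "k * ?h l + k * l = p * k"
          using that by (simp add: add_mult_distrib2[symmetric])
        then show ?thesis by (simp add: power_add[symmetric] one)
      qed simp
      moreover have "\<omega> ^ (k * ?h l) * cnj \<omega> ^ (k * ?h l) = 1"
        by (simp add: power_mult_distrib[symmetric] c)
      ultimately show ?thesis by (metis mult_cancel_left mult_zero_left zero_neq_one)
    qed
    have s: "s (?h l) = s l" if "l < p" for l
      using that dft_slice_cnj[of l A] by (simp add: s_def p_def singular_values_cnj)
    have "cnj (\<Sum>l<p. cnj \<omega> ^ (k * l) * s l) = (\<Sum>l<p. \<omega> ^ (k * l) * s l)"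
      by (simp add: s_def)
    also have "\<dots> = (\<Sum>l<p. cnj \<omega> ^ (k * ?h l) * s (?h l))"
      by (rule sum.cong) (simp_all add: * s)
    also have "\<dots> = (\<Sum>l<p. cnj \<omega> ^ (k * l) * s l)"
      by (rule sum.reindex_bij_betw[OF h])
    finally show ?thesis .
  qed simp
  then have "(\<Sum>l<p. cnj \<omega> ^ (k * l) * s l) \<in> \<real>" by (simp add: Reals_cnj_iff)
  then show ?thesis
    unfolding KM_coeff_def Let_def p_def[symmetric] \<omega>_def[symmetric] s_def[symmetric]
    by (intro Reals_mult) (auto intro!: Reals_divide)
qed

end

theory Submission
  imports Defs "HOL-Analysis.L2_Norm"
begin

text \<open>
  The discrete Fourier transform along the third mode turns the T-product into the slicewise
  product of complex matrices (\<open>dft_prod\<close>), transposition into the adjoint (\<open>dft_transpose\<close>),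
  orthogonal tensors into families of unitary matrices (\<open>unitary_dft\<close>), and it preserves the
  Frobenius norm up to the factor \<open>\<surd>p\<close> (\<open>frob_norm_dft\<close>). A Kilmer-Martin T-SVD \<open>A = U * S * V\<^sup>T\<close>
  thus becomes a family of singular value decompositions of the Fourier slices of \<open>A\<close>, with the
  matrices of singular values as slices of the transform of \<open>S\<close> (\<open>dft_KM_S\<close>).

  The Fourier slices of \<open>A\<^sub>1\<close> are unitarily equivalent to matrices with at most one nonzero entry,
  of modulus \<open>\<sigma>\<^sub>1\<close> in each slice. Hence the singular values of a slice are \<open>\<sigma>\<^sub>1, 0, 0, \<dots>\<close> for
  every slice, and the inverse transform of a constant family has at most one nonzero entry:
  \<open>A\<^sub>1\<close> has T-rank at most one. Unitary invariance also gives \<open>\<parallel>A - A\<^sub>1\<parallel>\<^sup>2 = \<parallel>S - S\<^sub>1\<parallel>\<^sup>2 = \<parallel>S\<parallel>\<^sup>2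
  - \<sigma>\<^sub>1\<^sup>2\<close>, with \<open>S\<^sub>1\<close> the truncation of \<open>S\<close>.

  Conversely, if \<open>B\<close> has T-rank at most one, then all its Fourier slices have the same singular
  values \<open>s, 0, 0, \<dots>\<close> (\<open>T_rank_le_1D\<close>). They are of rank at most one, so the inner product of the
  slices of \<open>A\<close> and \<open>B\<close> is at most \<open>s\<close> times the largest singular value of the slice of \<open>A\<close>
  (\<open>frobenius_sq_diag_minus_rank_one\<close>). The mean of these largest singular values is the leading
  diagonal entry \<open>t\<close> of \<open>S\<close> (\<open>KM_S_leading_entry\<close>), and averaging over the slices yields \<open>\<parallel>A -
  B\<parallel>\<^sup>2 \<ge> \<parallel>S\<parallel>\<^sup>2 - 2 t s + s\<^sup>2 \<ge> \<parallel>S\<parallel>\<^sup>2 - t\<^sup>2 \<ge> \<parallel>S\<parallel>\<^sup>2 - \<sigma>\<^sub>1\<^sup>2 = \<parallel>A - A\<^sub>1\<parallel>\<^sup>2\<close>.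
\<close>

section \<open>Gram matrices and unitary equivalence\<close>

definition unitary_mat :: "nat \<Rightarrow> complex mat \<Rightarrow> bool" where
  "unitary_mat n U \<longleftrightarrow> U \<in> carrier_mat n n \<and> mat_adjoint U * U = 1\<^sub>m n \<and> U * mat_adjoint U = 1\<^sub>m n"

definition frobenius_sq :: "complex mat \<Rightarrow> real" where
  "frobenius_sq M = (\<Sum>i<dim_row M. \<Sum>j<dim_col M. (cmod (M $$ (i, j)))\<^sup>2)"

lemma mat_adjoint_dim [simp]:
  "dim_row (mat_adjoint M) = dim_col M" "dim_col (mat_adjoint M) = dim_row M"
  by (simp_all add: mat_adjoint_def)

lemma mat_adjoint_index [simp]:
  fixes M :: "complex mat"
  assumes "i < dim_col M" "j < dim_row M"
  shows "mat_adjoint M $$ (i, j) = cnj (M $$ (j, i))"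
  using assms by (simp add: mat_adjoint_def mat_of_rows_index conjugate_complex_def)

lemma mat_adjoint_carrier [simp]:
  "M \<in> carrier_mat m n \<Longrightarrow> mat_adjoint M \<in> carrier_mat n m"
  by (rule carrier_matI) auto

lemma mat_adjoint_adjoint [simp]: "mat_adjoint (mat_adjoint M) = (M :: complex mat)"
  by (rule eq_matI) auto

lemma index_mult_sum:
  assumes "A \<in> carrier_mat a b" "B \<in> carrier_mat b c" "i < a" "j < c"
  shows "(A * B) $$ (i, j) = (\<Sum>k<b. A $$ (i, k) * B $$ (k, j))"
  using assms by (simp add: scalar_prod_def lessThan_atLeast0)

lemma index_mult_mat_vec_sum:
  assumes "A \<in> carrier_mat a b" "v \<in> carrier_vec b" "i < a"
  shows "(A *\<^sub>v v) $ i = (\<Sum>k<b. A $$ (i, k) * v $ k)"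
  using assms by (simp add: scalar_prod_def lessThan_atLeast0)

lemma mat_adjoint_mult:
  fixes A B :: "complex mat"
  assumes A: "A \<in> carrier_mat a b" and B: "B \<in> carrier_mat b c"
  shows "mat_adjoint (A * B) = mat_adjoint B * mat_adjoint A"
proof (rule eq_matI)
  fix i j assume "i < dim_row (mat_adjoint B * mat_adjoint A)" "j < dim_col (mat_adjoint B * mat_adjoint A)"
  then have ij: "i < c" "j < a" using A B by auto
  show "mat_adjoint (A * B) $$ (i, j) = (mat_adjoint B * mat_adjoint A) $$ (i, j)"
    using A B ij index_mult_sum[OF A B ij(2,1)]
      index_mult_sum[OF mat_adjoint_carrier[OF B] mat_adjoint_carrier[OF A] ij]
    by (simp add: mult.commute)
qed (use A B in auto)

text \<open>
  With \<open>V\<close> unitary, \<open>(U M V\<^sup>*)\<^sup>* (U M V\<^sup>*) = V (M\<^sup>* M) V\<^sup>*\<close>, because \<open>U\<^sup>* U\<close> cancels in the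
  middle. Since singular values are read off from the characteristic polynomial of the Gram
  matrix, their unitary invariance is then the similarity invariance of that polynomial.
\<close>

lemma gram_unitary_similar:
  assumes U: "unitary_mat m U" and V: "unitary_mat n V" and M: "M \<in> carrier_mat m n"
  shows "similar_mat (mat_adjoint (U * M * mat_adjoint V) * (U * M * mat_adjoint V))
    (mat_adjoint M * M)"
proof (rule similar_matI[where P = V and Q = "mat_adjoint V"])
  have c: "U \<in> carrier_mat m m" "V \<in> carrier_mat n n"
    and u: "mat_adjoint U * U = 1\<^sub>m m" "mat_adjoint V * V = 1\<^sub>m n" "V * mat_adjoint V = 1\<^sub>m n"
    using U V by (auto simp: unitary_mat_def)
  have cs: "mat_adjoint U \<in> carrier_mat m m" "mat_adjoint V \<in> carrier_mat n n"
    "mat_adjoint M \<in> carrier_mat n m" "U * M \<in> carrier_mat m n"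
    using c M by auto
  have adj: "mat_adjoint (U * M * mat_adjoint V) = V * (mat_adjoint M * mat_adjoint U)"
    by (simp add: mat_adjoint_mult[OF cs(4,2)] mat_adjoint_mult[OF c(1) M])
  have "mat_adjoint (U * M * mat_adjoint V) * (U * M * mat_adjoint V)
      = V * (mat_adjoint M * (mat_adjoint U * U) * M) * mat_adjoint V"
    unfolding adj using c cs M
    by (smt (verit) assoc_mult_mat mult_carrier_mat)
  then show "mat_adjoint (U * M * mat_adjoint V) * (U * M * mat_adjoint V)
      = V * (mat_adjoint M * M) * mat_adjoint V"
    by (simp add: u(1) right_mult_one_mat[OF cs(3)])
  show "V * mat_adjoint V = 1\<^sub>m n" "mat_adjoint V * V = 1\<^sub>m n" by fact+
  show "{mat_adjoint (U * M * mat_adjoint V) * (U * M * mat_adjoint V), mat_adjoint M * M, V, mat_adjoint V}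
    \<subseteq> carrier_mat n n"
    using c cs M by auto
qed

lemma singular_values_unitary:
  assumes "unitary_mat m U" "unitary_mat n V" "M \<in> carrier_mat m n"
  shows "singular_values (U * M * mat_adjoint V) = singular_values M"
  using char_poly_similar[OF gram_unitary_similar[OF assms]] by (simp add: singular_values_def)

lemma proots_prod_list_linear: "proots (\<Prod>a\<leftarrow>as. [:- a, 1:]) = mset (as :: complex list)"
proof (induction as)
  case (Cons a as)
  have "(\<Prod>a\<leftarrow>as. [:- a, 1:]) \<noteq> 0" by (auto simp: prod_list_zero_iff)
  then show ?case
    using Cons proots_linear_factor[of "-a"] by (simp add: proots_mult del: mult_pCons_left)
qed simp

lemma sum_diag_mult_commute:
  fixes A :: "complex mat"
  assumes A: "A \<in> carrier_mat m n" and B: "B \<in> carrier_mat n m"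
  shows "sum_list (diag_mat (A * B)) = sum_list (diag_mat (B * A))"
proof -
  have "sum_list (diag_mat (A * B)) = (\<Sum>i<m. \<Sum>k<n. A $$ (i, k) * B $$ (k, i))"
    using A index_mult_sum[OF A B]
    by (simp add: diag_mat_def sum_list_distinct_conv_sum_set lessThan_atLeast0 del: index_mult_mat(1))
  also have "\<dots> = (\<Sum>k<n. \<Sum>i<m. B $$ (k, i) * A $$ (i, k))"
    by (subst sum.swap) (simp add: mult.commute)
  also have "\<dots> = sum_list (diag_mat (B * A))"
    using B index_mult_sum[OF B A]
    by (simp add: diag_mat_def sum_list_distinct_conv_sum_set lessThan_atLeast0 del: index_mult_mat(1))
  finally show ?thesis .
qed

text \<open>
  Triangularize by Schur: the trace is invariant under similarity, and on the diagonal of a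
  triangular matrix stand the roots of its characteristic polynomial.
\<close>

lemma sum_diag_eq_sum_eigenvalues:
  fixes A :: "complex mat"
  assumes A: "A \<in> carrier_mat n n"
  shows "sum_list (diag_mat A) = sum_mset (proots (char_poly A))"
proof -
  obtain as where "char_poly A = (\<Prod>a\<leftarrow>as. [:- a, 1:])"
    using char_poly_factorized[OF A] by blast
  then obtain B where B: "B \<in> carrier_mat n n" "upper_triangular B" "similar_mat A B"
    using schur_decomposition_exists[OF A] by blast
  then obtain P Q where w: "similar_mat_wit A B P Q" by (auto simp: similar_mat_def)
  note W = similar_mat_witD2[OF A w]
  have "sum_list (diag_mat A) = sum_list (diag_mat (Q * (P * B)))"
    unfolding W(3) using W by (intro sum_diag_mult_commute[of _ n n]) auto
  also have "Q * (P * B) = B"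
    using W by (simp add: assoc_mult_mat[symmetric, of Q n n P n B n])
  finally show ?thesis
    using char_poly_similar[OF B(3)] char_poly_upper_triangular[OF B(1,2)]
    by (simp add: proots_prod_list_linear sum_mset_sum_list)
qed

lemma sum_diag_gram: 
  fixes M :: "complex mat"
  shows "sum_list (diag_mat (mat_adjoint M * M)) = complex_of_real (frobenius_sq M)"
proof -
  let ?m = "dim_row M" and ?n = "dim_col M"
  have M: "M \<in> carrier_mat ?m ?n" and M': "mat_adjoint M \<in> carrier_mat ?n ?m" by auto
  have "sum_list (diag_mat (mat_adjoint M * M)) = (\<Sum>j<?n. \<Sum>i<?m. cnj (M $$ (i, j)) * M $$ (i, j))"
    using index_mult_sum[OF M' M]
    by (simp add: diag_mat_def sum_list_distinct_conv_sum_set lessThan_atLeast0 del: index_mult_mat(1))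
  also have "\<dots> = (\<Sum>i<?m. \<Sum>j<?n. complex_of_real ((cmod (M $$ (i, j)))\<^sup>2))"
    by (subst sum.swap) (simp add: complex_norm_square mult.commute del: of_real_power)
  finally show ?thesis by (simp add: frobenius_sq_def)
qed

text \<open>
  A normalized eigenvector \<open>v\<close> of \<open>M\<^sup>* M\<close>, together with \<open>w = M v\<close>. From \<open>M\<^sup>* w = z v\<close> one gets
  \<open>\<parallel>w\<parallel>\<^sup>2 = v\<^sup>* M\<^sup>* M v = z\<close>, so that \<open>z\<close> is real and nonnegative.
\<close>

lemma gram_eigenvector:
  fixes M :: "complex mat"
  assumes M: "M \<in> carrier_mat m n" and z: "poly (char_poly (mat_adjoint M * M)) z = 0"
  obtains v w :: "nat \<Rightarrow> complex"
  where "(\<Sum>j<n. (cmod (v j))\<^sup>2) = 1"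
    and "\<And>i. i < m \<Longrightarrow> (\<Sum>j<n. M $$ (i, j) * v j) = w i"
    and "\<And>j. j < n \<Longrightarrow> (\<Sum>i<m. cnj (M $$ (i, j)) * w i) = z * v j"
    and "complex_of_real (\<Sum>i<m. (cmod (w i))\<^sup>2) = z"
proof -
  let ?G = "mat_adjoint M * M"
  have M': "mat_adjoint M \<in> carrier_mat n m" and G: "?G \<in> carrier_mat n n" using M by auto
  obtain u where "eigenvector ?G u z"
    using z eigenvalue_root_char_poly[OF G] by (auto simp: eigenvalue_def)
  then have u: "u \<in> carrier_vec n" "u \<noteq> 0\<^sub>v n" "?G *\<^sub>v u = z \<cdot>\<^sub>v u"
    using M by (auto simp: eigenvector_def)
  define N where "N = (\<Sum>j<n. (cmod (u $ j))\<^sup>2)"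
  have "N \<noteq> 0"
  proof
    assume "N = 0"
    then have "\<forall>j<n. u $ j = 0" by (auto simp: N_def sum_nonneg_eq_0_iff)
    then have "u = 0\<^sub>v n" using u(1) by (intro eq_vecI) auto
    with u(2) show False by simp
  qed
  moreover have "0 \<le> N" by (simp add: N_def sum_nonneg)
  ultimately have N: "0 < N" by simp
  define v where "v j = u $ j / complex_of_real (sqrt N)" for j
  define w where "w i = (\<Sum>j<n. M $$ (i, j) * v j)" for i
  have v1: "(\<Sum>j<n. (cmod (v j))\<^sup>2) = 1"
    using N by (simp add: v_def norm_divide power_divide sum_divide_distrib[symmetric] N_def[symmetric])
  have gv: "(\<Sum>i<m. cnj (M $$ (i, j)) * w i) = z * v j" if j: "j < n" for j
  proof -
    have "z * u $ j = (?G *\<^sub>v u) $ j" using u j by simp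
    also have "\<dots> = (\<Sum>k<n. ?G $$ (j, k) * u $ k)"
      by (rule index_mult_mat_vec_sum[OF G u(1) j])
    also have "\<dots> = (\<Sum>k<n. (\<Sum>i<m. cnj (M $$ (i, j)) * M $$ (i, k)) * u $ k)"
      using M M' j by (intro sum.cong refl) (simp add: index_mult_sum[OF M' M] del: index_mult_mat(1))
    also have "\<dots> = (\<Sum>i<m. cnj (M $$ (i, j)) * (\<Sum>k<n. M $$ (i, k) * u $ k))"
      by (simp add: sum_distrib_left sum_distrib_right mult.assoc) (rule sum.swap)
    finally have "z * u $ j = (\<Sum>i<m. cnj (M $$ (i, j)) * (\<Sum>k<n. M $$ (i, k) * u $ k))" .
    moreover have "w i = (\<Sum>k<n. M $$ (i, k) * u $ k) / complex_of_real (sqrt N)" for i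
      by (simp add: w_def v_def sum_divide_distrib)
    ultimately show ?thesis by (simp add: v_def sum_divide_distrib[symmetric])
  qed
  have "complex_of_real (\<Sum>i<m. (cmod (w i))\<^sup>2) = (\<Sum>i<m. cnj (w i) * w i)"
    by (simp add: complex_norm_square mult.commute del: of_real_power)
  also have "\<dots> = (\<Sum>i<m. \<Sum>j<n. cnj (v j) * (cnj (M $$ (i, j)) * w i))"
    by (rule sum.cong) (simp_all add: w_def sum_distrib_left sum_distrib_right mult_ac)
  also have "\<dots> = (\<Sum>j<n. cnj (v j) * (\<Sum>i<m. cnj (M $$ (i, j)) * w i))"
    by (subst sum.swap) (simp add: sum_distrib_left)
  also have "\<dots> = (\<Sum>j<n. z * complex_of_real ((cmod (v j))\<^sup>2))"
    using gv by (intro sum.cong) (simp_all add: complex_norm_square mult_ac del: of_real_power)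
  also have "\<dots> = z" using v1 by (simp add: sum_distrib_left[symmetric] of_real_sum[symmetric] del: of_real_power of_real_sum)
  finally show thesis using that[of v w] v1 gv by (simp add: w_def)
qed

section \<open>Singular values\<close>

text \<open>
  A pair of singular vectors that belongs to \<open>s\<close>, the left one being scaled to length \<open>s\<close>.
\<close>

lemma singular_values_eigen:
  assumes M: "M \<in> carrier_mat m n" and s: "s \<in> set (singular_values M)"
  obtains v w :: "nat \<Rightarrow> complex"
  where "0 \<le> s" and "(\<Sum>j<n. (cmod (v j))\<^sup>2) = 1" and "(\<Sum>i<m. (cmod (w i))\<^sup>2) = s\<^sup>2"
    and "\<And>i. i < m \<Longrightarrow> (\<Sum>j<n. M $$ (i, j) * v j) = w i"
    and "\<And>j. j < n \<Longrightarrow> (\<Sum>i<m. cnj (M $$ (i, j)) * w i) = complex_of_real (s\<^sup>2) * v j"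
proof -
  let ?G = "mat_adjoint M * M"
  have G: "?G \<in> carrier_mat n n" using M by auto
  from s obtain z where z: "z \<in># proots (char_poly ?G)" "s = sqrt (Re z)"
    by (auto simp: singular_values_def)
  then have "poly (char_poly ?G) z = 0"
    using degree_monic_char_poly[OF G] by (cases "char_poly ?G = 0") auto
  from gram_eigenvector[OF M this] obtain v w where vw:
    "(\<Sum>j<n. (cmod (v j))\<^sup>2) = 1"
    "\<And>i. i < m \<Longrightarrow> (\<Sum>j<n. M $$ (i, j) * v j) = w i"
    "\<And>j. j < n \<Longrightarrow> (\<Sum>i<m. cnj (M $$ (i, j)) * w i) = z * v j"
    "complex_of_real (\<Sum>i<m. (cmod (w i))\<^sup>2) = z" by blast
  define r where "r = (\<Sum>i<m. (cmod (w i))\<^sup>2)"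
  have zr: "z = complex_of_real r" and "0 \<le> r" using vw(4) by (simp_all add: r_def sum_nonneg)
  then have sr: "0 \<le> s" "s\<^sup>2 = r" using z(2) by simp_all
  show thesis
    using vw(3) that[OF sr(1) vw(1) _ vw(2)] unfolding sr(2) zr r_def by blast
qed

lemma singular_values_nonneg:
  "s \<in> set (singular_values M) \<Longrightarrow> 0 \<le> s"
  by (rule singular_values_eigen[of M "dim_row M" "dim_col M" s]) auto

lemma length_singular_values:
  assumes M: "M \<in> carrier_mat m n"
  shows "length (singular_values M) = n"
proof -
  have "mat_adjoint M * M \<in> carrier_mat n n" using M by auto
  from degree_monic_char_poly[OF this] show ?thesis
    unfolding singular_values_def length_rev
    by (metis size_mset mset_sorted_list_of_multiset size_image_mset size_proots_complex)
qed

lemma singular_values_antimono: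
  assumes "M \<in> carrier_mat m n" "i \<le> j" "j < n"
  shows "singular_values M ! j \<le> singular_values M ! i"
proof -
  have "sorted (rev (singular_values M))" by (simp add: singular_values_def)
  from sorted_rev_nth_mono[OF this assms(2)] show ?thesis
    using assms length_singular_values[OF assms(1)] by simp
qed

text \<open>
  Both sides are the trace of \<open>M\<^sup>* M\<close>.
\<close>

lemma frobenius_sq_eq_sum_singular_values:
  assumes M: "M \<in> carrier_mat m n"
  shows "frobenius_sq M = (\<Sum>i<n. (singular_values M ! i)\<^sup>2)"
proof -
  let ?G = "mat_adjoint M * M"
  have G: "?G \<in> carrier_mat n n" using M by auto
  have real: "Re z = (sqrt (Re z))\<^sup>2" if "z \<in># proots (char_poly ?G)" for z
  proof -
    have "poly (char_poly ?G) z = 0"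
      using that degree_monic_char_poly[OF G] by (cases "char_poly ?G = 0") auto
    from gram_eigenvector[OF M this] obtain w where
      "complex_of_real (\<Sum>i<m. (cmod (w i))\<^sup>2) = z" by metis
    then have "0 \<le> Re z" by (metis Re_complex_of_real sum_nonneg zero_le_power2)
    then show ?thesis by simp
  qed
  have Re_sum: "Re (sum_mset X) = (\<Sum>z\<in>#X. Re z)" for X by (induction X) simp_all
  have "complex_of_real (frobenius_sq M) = sum_mset (proots (char_poly ?G))"
    using sum_diag_gram[of M] sum_diag_eq_sum_eigenvalues[OF G] by simp
  then have "frobenius_sq M = Re (sum_mset (proots (char_poly ?G)))" by (metis Re_complex_of_real)
  also have "\<dots> = (\<Sum>z\<in>#proots (char_poly ?G). Re z)"
    by (rule Re_sum)
  also have "\<dots> = (\<Sum>z\<in>#proots (char_poly ?G). (sqrt (Re z))\<^sup>2)"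
    by (intro arg_cong[of _ _ sum_mset] image_mset_cong real)
  also have "\<dots> = (\<Sum>s\<in>#mset (singular_values M). s\<^sup>2)"
    by (simp add: singular_values_def image_mset.compositionality o_def)
  also have "\<dots> = sum_list (map (\<lambda>s. s\<^sup>2) (singular_values M))"
    by (metis mset_map sum_mset_sum_list)
  also have "\<dots> = (\<Sum>i<n. (singular_values M ! i)\<^sup>2)"
    by (simp add: sum_list_sum_nth length_singular_values[OF M] lessThan_atLeast0)
  finally show ?thesis .
qed

text \<open>
  The list of singular values has one entry for each column, but only the first \<open>min m n\<close> of them
  are assumed to vanish after the leading one. If \<open>m > 1\<close> the others vanish too, since the list
  is non-increasing. If \<open>m = 1\<close> then \<open>M\<close> is a row, and unless it is zero, its conjugate transpose
  is an eigenvector of \<open>M\<^sup>* M\<close> for the eigenvalue \<open>\<parallel>M\<parallel>\<^sup>2\<close>, and so \<open>\<parallel>M\<parallel>\<close> is itself a singular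
  value.
\<close>

lemma frobenius_sq_eq_sq_singular_value:
  assumes M: "M \<in> carrier_mat m n" and n: "0 < n" and m: "0 < m"
    and zero: "\<And>i. 0 < i \<Longrightarrow> i < min m n \<Longrightarrow> singular_values M ! i = 0"
  shows "frobenius_sq M = (singular_values M ! 0)\<^sup>2"
proof -
  let ?s = "\<lambda>i. singular_values M ! i"
  have split: "frobenius_sq M = (?s 0)\<^sup>2 + (\<Sum>i\<in>{0<..<n}. (?s i)\<^sup>2)"
  proof -
    have "{..<n} = insert 0 {0<..<n}" using n by auto
    then show ?thesis by (simp add: frobenius_sq_eq_sum_singular_values[OF M])
  qed
  have nn: "0 \<le> ?s i" if "i < n" for i
    using that length_singular_values[OF M] by (intro singular_values_nonneg[of _ M]) simp
  have "frobenius_sq M \<le> (?s 0)\<^sup>2"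
  proof (cases "m = 1")
    case False
    have "?s i = 0" if i: "0 < i" "i < n" for i
    proof -
      have "?s i \<le> ?s 1" using singular_values_antimono[OF M, of 1 i] i by simp
      also have "?s 1 = 0" using zero[of 1] i m False by simp
      finally show ?thesis using nn[of i] i by simp
    qed
    then show ?thesis unfolding split by simp
  next
    case m1: True
    show ?thesis
    proof (cases "frobenius_sq M = 0")
      case False
      let ?G = "mat_adjoint M * M"
      define u where "u = vec n (\<lambda>j. cnj (M $$ (0, j)))"
      have M': "mat_adjoint M \<in> carrier_mat n m" and G: "?G \<in> carrier_mat n n" using M by auto
      have u: "u \<in> carrier_vec n" by (simp add: u_def)
      have f: "frobenius_sq M = (\<Sum>j<n. (cmod (M $$ (0, j)))\<^sup>2)" using M m1 by (simp add: frobenius_sq_def)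
      have "?G *\<^sub>v u = complex_of_real (frobenius_sq M) \<cdot>\<^sub>v u"
      proof (rule eq_vecI)
        fix j assume "j < dim_vec (complex_of_real (frobenius_sq M) \<cdot>\<^sub>v u)"
        then have j: "j < n" by (simp add: u_def)
        have "(?G *\<^sub>v u) $ j = (\<Sum>k<n. ?G $$ (j, k) * u $ k)"
          by (rule index_mult_mat_vec_sum[OF G u j])
        also have "\<dots> = (\<Sum>k<n. cnj (M $$ (0, j)) * complex_of_real ((cmod (M $$ (0, k)))\<^sup>2))"
          using M j m1 by (intro sum.cong refl)
            (simp add: index_mult_sum[OF M' M] u_def complex_norm_square del: index_mult_mat(1) of_real_power)
        finally show "(?G *\<^sub>v u) $ j = (complex_of_real (frobenius_sq M) \<cdot>\<^sub>v u) $ j"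
          using j by (simp add: u_def f sum_distrib_left mult.commute)
      qed (use G u in auto)
      moreover have "u \<noteq> 0\<^sub>v n"
      proof
        assume "u = 0\<^sub>v n"
        then have "cnj (M $$ (0, j)) = 0" if "j < n" for j
          using that by (metis u_def index_vec index_zero_vec(1))
        then show False using False by (simp add: f)
      qed
      ultimately have "eigenvector ?G u (complex_of_real (frobenius_sq M))"
        using u M by (simp add: eigenvector_def)
      then have "poly (char_poly ?G) (complex_of_real (frobenius_sq M)) = 0"
        using eigenvalue_root_char_poly[OF G] by (auto simp: eigenvalue_def)
      moreover have "char_poly ?G \<noteq> 0" using degree_monic_char_poly[OF G] by auto
      ultimately have "complex_of_real (frobenius_sq M) \<in># proots (char_poly ?G)" by simp
      then have "sqrt (frobenius_sq M) \<in> set (singular_values M)"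
        by (force simp: singular_values_def)
      then obtain i where i: "i < n" "?s i = sqrt (frobenius_sq M)"
        using length_singular_values[OF M] by (metis in_set_conv_nth)
      have "sqrt (frobenius_sq M) \<le> ?s 0" using singular_values_antimono[OF M _ i(1), of 0] i by simp
      then show ?thesis using real_le_lsqrt[of "frobenius_sq M" "?s 0"] nn[OF n] f
        by (metis real_sqrt_le_iff real_sqrt_abs abs_of_nonneg)
    qed simp
  qed
  then show ?thesis unfolding split by (simp add: sum_nonneg dual_order.antisym)
qed

section \<open>Rank one matrices\<close>

text \<open>
  If the leading singular value \<open>s\<close> exhausts the Frobenius norm, then \<open>M\<close> has rank at most one.
  Take a unit vector \<open>v\<close> with \<open>M\<^sup>* M v = s\<^sup>2 v\<close> and \<open>w = M v\<close>; then \<open>\<parallel>M - w v\<^sup>*\<parallel>\<^sup>2 = \<parallel>M\<parallel>\<^sup>2 - 2 Re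
  (w\<^sup>* M v) + \<parallel>w\<parallel>\<^sup>2 = s\<^sup>2 - 2 s\<^sup>2 + s\<^sup>2 = 0\<close>.
\<close>

lemma rank_one_factorization:
  assumes M: "M \<in> carrier_mat m n" and n: "0 < n"
    and f: "frobenius_sq M = (singular_values M ! 0)\<^sup>2"
  obtains v w :: "nat \<Rightarrow> complex"
  where "(\<Sum>j<n. (cmod (v j))\<^sup>2) = 1" and "(\<Sum>i<m. (cmod (w i))\<^sup>2) = (singular_values M ! 0)\<^sup>2"
    and "\<And>i j. i < m \<Longrightarrow> j < n \<Longrightarrow> M $$ (i, j) = w i * cnj (v j)"
proof -
  define s where "s = singular_values M ! 0"
  have "s \<in> set (singular_values M)" using n length_singular_values[OF M] by (simp add: s_def)
  then show thesis
  proof (rule singular_values_eigen[OF M])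
    fix v w :: "nat \<Rightarrow> complex"
    assume vw: "0 \<le> s" "(\<Sum>j<n. (cmod (v j))\<^sup>2) = 1" "(\<Sum>i<m. (cmod (w i))\<^sup>2) = s\<^sup>2"
      "\<And>i. i < m \<Longrightarrow> (\<Sum>j<n. M $$ (i, j) * v j) = w i"
    let ?r = "\<lambda>i j. M $$ (i, j) - w i * cnj (v j)"
    have exp: "(cmod (?r i j))\<^sup>2 = (cmod (M $$ (i, j)))\<^sup>2 - 2 * Re (cnj (w i) * (M $$ (i, j) * v j))
        + (cmod (w i))\<^sup>2 * (cmod (v j))\<^sup>2" for i j
      unfolding cmod_power2 by (simp add: power2_eq_square algebra_simps)
    have sq: "Re (cnj z * z) = (cmod z)\<^sup>2" for z
      unfolding cmod_power2 by (simp add: power2_eq_square)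
    have "(\<Sum>i<m. \<Sum>j<n. (cmod (?r i j))\<^sup>2) =
        (\<Sum>i<m. (\<Sum>j<n. (cmod (M $$ (i, j)))\<^sup>2) - 2 * Re (cnj (w i) * (\<Sum>j<n. M $$ (i, j) * v j))
          + (cmod (w i))\<^sup>2 * (\<Sum>j<n. (cmod (v j))\<^sup>2))"
      unfolding exp by (simp add: sum.distrib sum_subtractf sum_distrib_left)
    also have "\<dots> = (\<Sum>i<m. (\<Sum>j<n. (cmod (M $$ (i, j)))\<^sup>2) - (cmod (w i))\<^sup>2)"
      using vw(2,4) sq by (intro sum.cong refl) (simp del: complex_cnj_mult)
    also have "\<dots> = frobenius_sq M - s\<^sup>2"
      using M vw(3) by (simp add: frobenius_sq_def sum_subtractf)
    also have "\<dots> = 0" using f by (simp add: s_def)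
    finally have "\<forall>i<m. \<forall>j<n. ?r i j = 0"
      by (simp add: sum_nonneg_eq_0_iff sum_nonneg)
    then show thesis using that[of v w] vw(2,3) by (simp add: s_def)
  qed
qed

text \<open>
  The rank one case of von Neumann's trace inequality. For \<open>M = w v\<^sup>*\<close> with \<open>\<parallel>v\<parallel> = 1\<close> and \<open>\<parallel>w\<parallel> =
  s\<close>, and \<open>D\<close> diagonal, the inner product \<open>Re \<langle>D, M\<rangle>\<close> is at most \<open>\<sigma> \<Sum>\<^sub>i |w\<^sub>i| |v\<^sub>i|\<close>, hence at
  most \<open>\<sigma> s\<close> by Cauchy and Schwarz; now expand \<open>\<parallel>D - M\<parallel>\<^sup>2\<close>.
\<close>

lemma frobenius_sq_diag_minus_rank_one:
  assumes D: "D \<in> carrier_mat m n" and M: "M \<in> carrier_mat m n" and n: "0 < n"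
    and f: "frobenius_sq M = (singular_values M ! 0)\<^sup>2"
    and off: "\<And>i j. i < m \<Longrightarrow> j < n \<Longrightarrow> i \<noteq> j \<Longrightarrow> D $$ (i, j) = 0"
    and diag: "\<And>i. i < min m n \<Longrightarrow> cmod (D $$ (i, i)) \<le> \<sigma>"
  shows "frobenius_sq D - 2 * \<sigma> * singular_values M ! 0 + (singular_values M ! 0)\<^sup>2 \<le> frobenius_sq (D - M)"
proof -
  define s where "s = singular_values M ! 0"
  have s0: "0 \<le> s"
    unfolding s_def using n length_singular_values[OF M]
    by (intro singular_values_nonneg[of _ M]) simp
  obtain v w :: "nat \<Rightarrow> complex" where vw:
    "(\<Sum>j<n. (cmod (v j))\<^sup>2) = 1" "(\<Sum>i<m. (cmod (w i))\<^sup>2) = s\<^sup>2"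
    "\<And>i j. i < m \<Longrightarrow> j < n \<Longrightarrow> M $$ (i, j) = w i * cnj (v j)"
    using rank_one_factorization[OF M n f] unfolding s_def by metis
  let ?k = "min m n"
  have \<sigma>: "0 \<le> \<sigma>" if "0 < ?k" using diag[OF that] norm_ge_zero order_trans by blast
  have inner: "(\<Sum>i<m. \<Sum>j<n. Re (cnj (D $$ (i, j)) * M $$ (i, j))) \<le> \<sigma> * s"
  proof -
    have row: "(\<Sum>j<n. Re (cnj (D $$ (i, j)) * M $$ (i, j)))
        = (if i < n then Re (cnj (D $$ (i, i)) * M $$ (i, i)) else 0)" if i: "i < m" for i
    proof -
      have "(\<Sum>j<n. Re (cnj (D $$ (i, j)) * M $$ (i, j)))
          = (\<Sum>j<n. if j = i then Re (cnj (D $$ (i, i)) * M $$ (i, i)) else 0)"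
        using off i by (intro sum.cong) auto
      then show ?thesis by simp
    qed
    have "(\<Sum>i<m. \<Sum>j<n. Re (cnj (D $$ (i, j)) * M $$ (i, j)))
        = (\<Sum>i<m. if i < n then Re (cnj (D $$ (i, i)) * M $$ (i, i)) else 0)"
      using row by (intro sum.cong) auto
    also have "\<dots> = (\<Sum>i<?k. Re (cnj (D $$ (i, i)) * M $$ (i, i)))"
      by (rule sum.mono_neutral_cong_right) auto
    also have "\<dots> \<le> (\<Sum>i<?k. \<sigma> * (cmod (w i) * cmod (v i)))"
    proof (rule sum_mono)
      fix i assume "i \<in> {..<?k}"
      then have i: "i < ?k" by simp
      have "Re (cnj (D $$ (i, i)) * M $$ (i, i)) \<le> cmod (D $$ (i, i)) * (cmod (w i) * cmod (v i))"
        using complex_Re_le_cmod[of "cnj (D $$ (i, i)) * M $$ (i, i)"] i vw(3)[of i i]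
        by (simp add: norm_mult)
      also have "\<dots> \<le> \<sigma> * (cmod (w i) * cmod (v i))"
        using diag[OF i] by (intro mult_right_mono) auto
      finally show "Re (cnj (D $$ (i, i)) * M $$ (i, i)) \<le> \<sigma> * (cmod (w i) * cmod (v i))" .
    qed
    also have "\<dots> \<le> \<sigma> * s"
    proof (cases "?k = 0")
      case True
      then have "m = 0" using n by simp
      then have "s = 0" using vw(2) by simp
      then show ?thesis using True by simp
    next
      case False
      have "(\<Sum>i<?k. cmod (w i) * cmod (v i))
          \<le> L2_set (\<lambda>i. cmod (w i)) {..<?k} * L2_set (\<lambda>i. cmod (v i)) {..<?k}"
        using L2_set_mult_ineq[of "\<lambda>i. cmod (w i)" "\<lambda>i. cmod (v i)" "{..<?k}"] by simp
      also have "\<dots> \<le> L2_set (\<lambda>i. cmod (w i)) {..<m} * L2_set (\<lambda>i. cmod (v i)) {..<n}"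
        unfolding L2_set_def
        by (intro mult_mono real_sqrt_le_mono sum_mono2) (auto intro: sum_nonneg)
      also have "\<dots> = s" using vw(1,2) s0 by (simp add: L2_set_def)
      finally show ?thesis
        using \<sigma> False by (simp add: sum_distrib_left[symmetric] mult_left_mono)
    qed
    finally show ?thesis .
  qed
  \<comment> \<open>Polarization of the squared modulus.\<close>
  have exp: "(cmod (x - y))\<^sup>2 = (cmod x)\<^sup>2 - 2 * Re (cnj x * y) + (cmod y)\<^sup>2" for x y
    unfolding cmod_power2 by (simp add: power2_eq_square algebra_simps)
  have "frobenius_sq (D - M) = (\<Sum>i<m. \<Sum>j<n. (cmod (D $$ (i, j) - M $$ (i, j)))\<^sup>2)"
    using D M by (simp add: frobenius_sq_def)
  also have "\<dots> = frobenius_sq D - 2 * (\<Sum>i<m. \<Sum>j<n. Re (cnj (D $$ (i, j)) * M $$ (i, j))) + frobenius_sq M"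
    unfolding exp using D M by (simp add: frobenius_sq_def sum.distrib sum_subtractf sum_distrib_left)
  finally show ?thesis using inner f unfolding s_def[symmetric] by simp
qed

lemma frobenius_sq_unitary:
  assumes "unitary_mat m U" "unitary_mat n V" "M \<in> carrier_mat m n"
  shows "frobenius_sq (U * M * mat_adjoint V) = frobenius_sq M"
proof -
  have "U * M * mat_adjoint V \<in> carrier_mat m n" using assms by (auto simp: unitary_mat_def)
  then show ?thesis
    using assms by (simp add: frobenius_sq_eq_sum_singular_values[where m = m and n = n] singular_values_unitary)
qed

lemma singular_values_single_entry:
  assumes E: "E \<in> carrier_mat m n" and i: "i < m" "i < n"
    and entries: "\<And>a b. a < m \<Longrightarrow> b < n \<Longrightarrow> E $$ (a, b) = (if a = i \<and> b = i then c else 0)"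
  shows "singular_values E = cmod c # replicate (n - 1) 0"
proof -
  let ?G = "mat_adjoint E * E"
  have E': "mat_adjoint E \<in> carrier_mat n m" and G: "?G \<in> carrier_mat n n" using E by auto
  have ent: "?G $$ (a, b) = (if a = i \<and> b = i then complex_of_real ((cmod c)\<^sup>2) else 0)"
    if "a < n" "b < n" for a b
  proof -
    have "?G $$ (a, b) = (\<Sum>k<m. cnj (E $$ (k, a)) * E $$ (k, b))"
      using that E by (simp add: index_mult_sum[OF E' E] del: index_mult_mat(1))
    also have "\<dots> = (\<Sum>k<m. if k = i then (if a = i \<and> b = i then cnj c * c else 0) else 0)"
      using that entries by (intro sum.cong) auto
    finally show ?thesis using i by (simp add: complex_norm_square mult.commute del: of_real_power)
  qed
  have "upper_triangular ?G" using G ent by (intro upper_triangularI) auto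
  from char_poly_upper_triangular[OF G this]
  have "proots (char_poly ?G) = mset (diag_mat ?G)" by (simp add: proots_prod_list_linear)
  also have "diag_mat ?G = map (\<lambda>k. if k = i then complex_of_real ((cmod c)\<^sup>2) else 0) [0..<n]"
    unfolding diag_mat_def using G ent by (intro map_cong) auto
  also have "mset \<dots> = add_mset (complex_of_real ((cmod c)\<^sup>2)) (replicate_mset (n - 1) 0)"
  proof -
    have "mset (map f [0..<n]) = image_mset f (mset_set {0..<n})" for f :: "nat \<Rightarrow> complex"
      by simp
    moreover have "mset_set {0..<n} = add_mset i (mset_set ({0..<n} - {i}))"
      using i by (metis atLeast0LessThan finite_atLeastLessThan lessThan_iff mset_set.remove)
    moreover have "image_mset (\<lambda>k. if k = i then complex_of_real ((cmod c)\<^sup>2) else 0)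
        (mset_set ({0..<n} - {i})) = image_mset (\<lambda>k. 0) (mset_set ({0..<n} - {i}))"
      by (rule image_mset_cong) auto
    ultimately show ?thesis using i by (simp add: image_mset_const_eq)
  qed
  finally have "image_mset (\<lambda>z. sqrt (Re z)) (proots (char_poly ?G))
      = mset (replicate (n - 1) 0 @ [cmod c])"
    by (simp del: of_real_power)
  then have "singular_values E = rev (sort (replicate (n - 1) 0 @ [cmod c]))"
    unfolding singular_values_def by (metis sorted_list_of_multiset_mset)
  also have "sort (replicate (n - 1) 0 @ [cmod c]) = replicate (n - 1) 0 @ [cmod c]"
    by (rule sort_key_id_if_sorted) (auto simp: sorted_append)
  finally show ?thesis by simp
qed

section \<open>The discrete Fourier transform\<close>

definition root_unity :: "nat \<Rightarrow> complex" where
  "root_unity p = cis (- 2 * pi / real p)"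

lemma root_unity_power: "0 < p \<Longrightarrow> root_unity p ^ p = 1"
  by (simp add: root_unity_def DeMoivre) (metis cis_2pi cis_cnj complex_cnj_one)

lemma root_unity_cnj: "root_unity p ^ a * cnj (root_unity p) ^ a = 1"
  by (simp add: root_unity_def power_mult_distrib[symmetric] complex_norm_square[symmetric])

lemma power_mod_period:
  fixes z :: "'a :: monoid_mult"
  assumes "z ^ p = 1"
  shows "z ^ (k mod p) = z ^ k"
proof -
  have "z ^ k = z ^ (p * (k div p) + k mod p)" by simp
  also have "\<dots> = z ^ (k mod p)" unfolding power_add power_mult assms by simp
  finally show ?thesis by simp
qed

lemma root_unity_power_mod:
  assumes "0 < p"
  shows "root_unity p ^ (l * (k mod p)) = root_unity p ^ (l * k)"
proof -
  have "(root_unity p ^ l) ^ p = 1"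
    by (metis assms mult.commute power_mult power_one root_unity_power)
  from power_mod_period[OF this] show ?thesis by (simp add: power_mult)
qed

text \<open>
  The sum is a geometric one whose ratio is a \<open>p\<close>-th root of unity different from \<open>1\<close> for \<open>k \<noteq>
  k'\<close>.
\<close>

lemma root_unity_orthogonal:
  assumes "k < p" "k' < p"
  shows "(\<Sum>l<p. root_unity p ^ (l * k) * cnj (root_unity p) ^ (l * k')) = (if k = k' then of_nat p else 0)"
proof -
  let ?w = "root_unity p"
  have p: "0 < p" using assms by simp
  define z where "z = ?w ^ k * cnj ?w ^ k'"
  have sum: "(\<Sum>l<p. ?w ^ (l * k) * cnj ?w ^ (l * k')) = (\<Sum>l<p. z ^ l)"
    by (rule sum.cong) (simp_all add: z_def power_mult_distrib power_mult[symmetric] mult.commute)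
  have "z ^ p = (?w ^ p) ^ k * cnj (?w ^ p) ^ k'"
    by (simp add: z_def power_mult_distrib power_mult[symmetric] mult.commute)
  then have zp: "z ^ p = 1" using root_unity_power[OF p] by simp
  show ?thesis
  proof (cases "k = k'")
    case True
    then show ?thesis unfolding sum by (simp add: z_def root_unity_cnj)
  next
    case False
    have "z \<noteq> 1"
    proof
      assume "z = 1"
      then have "cnj ?w ^ k = cnj ?w ^ k * (?w ^ k * cnj ?w ^ k')" by (simp add: z_def)
      also have "\<dots> = cnj ?w ^ k'" using root_unity_cnj[of p k] by (simp add: mult.commute mult.left_commute)
      finally have "cis (2 * pi * real k / real p) = cis (2 * pi * real k' / real p)"
        by (simp add: root_unity_def cis_cnj DeMoivre mult_ac)
      then show False
        using bij_betw_roots_unity[OF p] assms False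
        by (auto simp: bij_betw_def inj_on_def)
    qed
    then show ?thesis unfolding sum using geometric_sum[of z p] zp False by simp
  qed
qed

lemma dft_parseval:
  fixes f :: "nat \<Rightarrow> complex"
  shows "(\<Sum>l<p. (cmod (\<Sum>k<p. root_unity p ^ (l * k) * f k))\<^sup>2) = real p * (\<Sum>k<p. (cmod (f k))\<^sup>2)"
proof -
  let ?w = "root_unity p"
  have "complex_of_real (\<Sum>l<p. (cmod (\<Sum>k<p. ?w ^ (l * k) * f k))\<^sup>2)
      = (\<Sum>l<p. (\<Sum>k<p. ?w ^ (l * k) * f k) * (\<Sum>k'<p. cnj ?w ^ (l * k') * cnj (f k')))"
    by (simp add: complex_norm_square del: of_real_power)
  also have "\<dots> = (\<Sum>l<p. \<Sum>k<p. \<Sum>k'<p. f k * cnj (f k') * (?w ^ (l * k) * cnj ?w ^ (l * k')))"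
    by (simp add: sum_product mult_ac)
  also have "\<dots> = (\<Sum>k<p. \<Sum>k'<p. \<Sum>l<p. f k * cnj (f k') * (?w ^ (l * k) * cnj ?w ^ (l * k')))"
    by (subst sum.swap, rule sum.cong[OF refl], rule sum.swap)
  also have "\<dots> = (\<Sum>k<p. \<Sum>k'<p. if k = k' then f k * cnj (f k') * of_nat p else 0)"
    by (intro sum.cong refl) (simp add: sum_distrib_left[symmetric] root_unity_orthogonal)
  also have "\<dots> = complex_of_real (real p * (\<Sum>k<p. (cmod (f k))\<^sup>2))"
    by (simp add: sum_distrib_left complex_norm_square mult_ac del: of_real_power)
  finally show ?thesis by (simp only: of_real_eq_iff)
qed

lemma dft_inverse:
  fixes f :: "nat \<Rightarrow> complex"
  assumes l: "l < p"
  shows "(\<Sum>k<p. root_unity p ^ (l * k) * (1 / of_nat p * (\<Sum>l'<p. cnj (root_unity p) ^ (k * l') * f l'))) = f l"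
proof -
  let ?w = "root_unity p"
  have "(\<Sum>k<p. ?w ^ (l * k) * (1 / of_nat p * (\<Sum>l'<p. cnj ?w ^ (k * l') * f l')))
      = (\<Sum>k<p. \<Sum>l'<p. 1 / of_nat p * f l' * (?w ^ (k * l) * cnj ?w ^ (k * l')))"
    by (simp add: sum_distrib_left mult_ac)
  also have "\<dots> = (\<Sum>l'<p. 1 / of_nat p * f l' * (\<Sum>k<p. ?w ^ (k * l) * cnj ?w ^ (k * l')))"
    by (subst sum.swap) (simp add: sum_distrib_left)
  also have "\<dots> = (\<Sum>l'<p. if l = l' then f l' else 0)"
    using l by (intro sum.cong refl) (simp add: root_unity_orthogonal)
  also have "\<dots> = f l" using l by simp
  finally show ?thesis .
qed

section \<open>Tensors in the Fourier domain\<close>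

context
  fixes m n p :: nat and A :: tensor
  assumes A: "A \<in> carrier_tensor m n p" and p: "0 < p"
begin

lemma dft_slice_carrier [simp]: "dft_slice A l \<in> carrier_mat m n"
  using carrier_tensorD[OF A p] by (simp add: dft_slice_def Let_def)

lemma dft_slice_index:
  assumes "i < m" "j < n"
  shows "dft_slice A l $$ (i, j) = (\<Sum>k<p. root_unity p ^ (l * k) * complex_of_real (A ! k $$ (i, j)))"
  using carrier_tensorD[OF A p] assms by (simp add: dft_slice_def Let_def root_unity_def)

lemma frob_norm_power2:
  "(frob_norm A)\<^sup>2 = (\<Sum>k<p. \<Sum>i<m. \<Sum>j<n. (A ! k $$ (i, j))\<^sup>2)"
  using carrier_tensorD[OF A p] by (simp add: frob_norm_def sum_nonneg)

text \<open>
  Parseval, applied to each tube of entries \<open>(i, j)\<close>.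
\<close>

lemma frob_norm_dft: "(\<Sum>l<p. frobenius_sq (dft_slice A l)) = real p * (frob_norm A)\<^sup>2"
proof -
  have "(\<Sum>l<p. frobenius_sq (dft_slice A l)) = (\<Sum>l<p. \<Sum>i<m. \<Sum>j<n.
      (cmod (\<Sum>k<p. root_unity p ^ (l * k) * complex_of_real (A ! k $$ (i, j))))\<^sup>2)"
    using carrier_matD[OF dft_slice_carrier] by (simp add: frobenius_sq_def dft_slice_index)
  also have "\<dots> = (\<Sum>i<m. \<Sum>j<n. \<Sum>l<p.
      (cmod (\<Sum>k<p. root_unity p ^ (l * k) * complex_of_real (A ! k $$ (i, j))))\<^sup>2)"
    by (subst sum.swap, rule sum.cong[OF refl], rule sum.swap)
  also have "\<dots> = real p * (\<Sum>i<m. \<Sum>j<n. \<Sum>k<p. (A ! k $$ (i, j))\<^sup>2)"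
    unfolding dft_parseval by (simp add: sum_distrib_left)
  also have "(\<Sum>i<m. \<Sum>j<n. \<Sum>k<p. (A ! k $$ (i, j))\<^sup>2) = (frob_norm A)\<^sup>2"
    unfolding frob_norm_power2 by (subst (2) sum.swap, rule sum.cong[OF refl], rule sum.swap)
  finally show ?thesis .
qed

text \<open>
  Transposition transposes each slice and reverses the order of all slices but the first.
\<close>

lemma t_transpose_index:
  assumes "i < n" "j < m" "k < p"
  shows "t_transpose A ! k $$ (i, j) = A ! ((p - k) mod p) $$ (j, i)"
proof -
  note T = bcirc_t_transpose[OF p A]
  have "t_transpose A ! k $$ (i, j) = bcirc (t_transpose A) $$ (k * n + i, 0 * m + j)"
    using bcirc_block[OF T(2) assms p] assms by simp
  also have "\<dots> = bcirc A $$ (0 * m + j, k * n + i)"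
    unfolding T(1) using bcirc_carrier[OF A p] block_index[of i n k p] block_index[of j m 0 p] assms p
    by simp
  also have "\<dots> = A ! ((p - k) mod p) $$ (j, i)"
    using bcirc_block[OF A assms(2,1) p assms(3)] by simp
  finally show ?thesis .
qed

text \<open>
  Reversing the order of the slices conjugates the Fourier kernel, while the entries are real, so
  each Fourier slice is conjugated as well as transposed.
\<close>

lemma dft_transpose: "dft_slice (t_transpose A) l = mat_adjoint (dft_slice A l)"
proof (rule eq_matI)
  fix i j assume "i < dim_row (mat_adjoint (dft_slice A l))" "j < dim_col (mat_adjoint (dft_slice A l))"
  then have ij: "i < n" "j < m" using carrier_matD[OF dft_slice_carrier] by auto
  have T: "t_transpose A \<in> carrier_tensor n m p" by (rule bcirc_t_transpose[OF p A])
  let ?w = "root_unity p" and ?h = "\<lambda>k. (p - k) mod p"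
  have h: "bij_betw ?h {..<p} {..<p}"
  proof (rule bij_betw_byWitness[where f' = ?h])
    show "\<forall>l\<in>{..<p}. ?h (?h l) = l" "\<forall>l\<in>{..<p}. ?h (?h l) = l" by (auto simp: mod_if)
  qed (use p in auto)
  have w: "?w ^ (l * k) = cnj ?w ^ (l * ?h k)" if k: "k < p" for k
  proof -
    have "?w ^ (l * k) * ?w ^ (l * ?h k) = ?w ^ (l * (k + (p - k)))"
      by (simp add: root_unity_power_mod[OF p] power_add[symmetric] add_mult_distrib2 del: le_add_diff_inverse)
    also have "\<dots> = (?w ^ p) ^ l"
      using k by (simp add: power_mult[symmetric] mult.commute)
    also have "\<dots> = 1" by (simp add: root_unity_power[OF p])
    finally show ?thesis
      using root_unity_cnj[of p "l * ?h k"] by (metis mult.commute mult.left_commute mult_1_right)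
  qed
  have "dft_slice (t_transpose A) l $$ (i, j) = (\<Sum>k<p. ?w ^ (l * k) * complex_of_real (A ! ?h k $$ (j, i)))"
    using ij carrier_tensorD[OF T p] by (simp add: dft_slice_def Let_def root_unity_def t_transpose_index)
  also have "\<dots> = (\<Sum>k<p. cnj ?w ^ (l * ?h k) * complex_of_real (A ! ?h k $$ (j, i)))"
    using w by (intro sum.cong) auto
  also have "\<dots> = (\<Sum>k<p. cnj ?w ^ (l * k) * complex_of_real (A ! k $$ (j, i)))"
    by (rule sum.reindex_bij_betw[OF h])
  also have "\<dots> = mat_adjoint (dft_slice A l) $$ (i, j)"
    using ij carrier_matD[OF dft_slice_carrier] by (simp add: dft_slice_index)
  finally show "dft_slice (t_transpose A) l $$ (i, j) = mat_adjoint (dft_slice A l) $$ (i, j)" .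
next
  have T: "t_transpose A \<in> carrier_tensor n m p" by (rule bcirc_t_transpose[OF p A])
  show "dim_row (dft_slice (t_transpose A) l) = dim_row (mat_adjoint (dft_slice A l))"
    "dim_col (dft_slice (t_transpose A) l) = dim_col (mat_adjoint (dft_slice A l))"
    using carrier_tensorD[OF T p] carrier_matD[OF dft_slice_carrier] by (simp_all add: dft_slice_def Let_def)
qed

lemma t_prod_index:
  assumes B: "B \<in> carrier_tensor n q p" and "a < m" "b < q" "k < p"
  shows "(A *\<^sub>T B) ! k $$ (a, b) = (\<Sum>r<p. \<Sum>c<n. A ! ((k + p - r) mod p) $$ (a, c) * B ! r $$ (c, b))"
proof -
  note P = bcirc_t_prod[OF p A B]
  note cA = bcirc_carrier[OF A p] and cB = bcirc_carrier[OF B p]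
  have "(A *\<^sub>T B) ! k $$ (a, b) = (bcirc A * bcirc B) $$ (k * m + a, 0 * q + b)"
    using bcirc_block[OF P(2) assms(2-4) p] assms(4) unfolding P(1) by simp
  also have "\<dots> = (\<Sum>c<n * p. bcirc A $$ (k * m + a, c) * bcirc B $$ (c, 0 * q + b))"
    using block_index[of a m k p] block_index[of b q 0 p] assms
    by (intro index_mult_sum[OF cA cB]) auto
  also have "\<dots> = (\<Sum>r<p. \<Sum>c<n. bcirc A $$ (k * m + a, r * n + c) * bcirc B $$ (r * n + c, 0 * q + b))"
    by (rule sum_blocks)
  also have "\<dots> = (\<Sum>r<p. \<Sum>c<n. A ! ((k + p - r) mod p) $$ (a, c) * B ! r $$ (c, b))"
    using assms p
    by (intro sum.cong refl) (simp add: bcirc_block[OF A] bcirc_block[OF B _ _ _ p, simplified])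
  finally show ?thesis .
qed

text \<open>
  The T-product is a cyclic convolution of slices, which the Fourier transform turns into a
  slicewise matrix product.
\<close>

lemma dft_prod:
  assumes B: "B \<in> carrier_tensor n q p"
  shows "dft_slice (A *\<^sub>T B) l = dft_slice A l * dft_slice B l"
proof -
  note P = bcirc_t_prod(2)[OF p A B]
  have dB: "dft_slice B l \<in> carrier_mat n q"
    using carrier_tensorD[OF B p] by (simp add: dft_slice_def Let_def)
  have dP: "dft_slice (A *\<^sub>T B) l \<in> carrier_mat m q"
    using carrier_tensorD[OF P p] by (simp add: dft_slice_def Let_def)
  let ?w = "root_unity p"
  show ?thesis
  proof (rule eq_matI)
    fix a b assume "a < dim_row (dft_slice A l * dft_slice B l)" "b < dim_col (dft_slice A l * dft_slice B l)"
    then have ab: "a < m" "b < q" using dB carrier_matD[OF dft_slice_carrier] by auto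
    have shift: "(\<Sum>k<p. ?w ^ (l * k) * complex_of_real (A ! ((k + p - r) mod p) $$ (a, c)))
        = ?w ^ (l * r) * dft_slice A l $$ (a, c)" if r: "r < p" and c: "c < n" for r c
    proof -
      have w: "?w ^ (l * k) = ?w ^ (l * r) * ?w ^ (l * ((k + p - r) mod p))" if "k < p" for k
      proof -
        have "?w ^ (l * r) * ?w ^ (l * ((k + p - r) mod p)) = ?w ^ (l * (r + (k + p - r)))"
          by (simp add: root_unity_power_mod[OF p] power_add[symmetric] add_mult_distrib2)
        also have "r + (k + p - r) = k + p" using r by simp
        also have "?w ^ (l * (k + p)) = ?w ^ (l * ((k + p) mod p))"
          by (rule root_unity_power_mod[OF p, symmetric])
        finally show ?thesis using that by simp
      qed
      have "(\<Sum>k<p. ?w ^ (l * k) * complex_of_real (A ! ((k + p - r) mod p) $$ (a, c)))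
          = (\<Sum>k<p. ?w ^ (l * r) * (?w ^ (l * ((k + p - r) mod p)) * complex_of_real (A ! ((k + p - r) mod p) $$ (a, c))))"
        by (rule sum.cong[OF refl]) (subst w, simp_all add: mult.assoc)
      also have "\<dots> = (\<Sum>k<p. ?w ^ (l * r) * (?w ^ (l * k) * complex_of_real (A ! k $$ (a, c))))"
        by (rule sum.reindex_bij_betw[OF mod_shift_bij[OF r]])
      finally show ?thesis using ab c by (simp add: dft_slice_index sum_distrib_left)
    qed
    have "dft_slice (A *\<^sub>T B) l $$ (a, b) = (\<Sum>k<p. ?w ^ (l * k) * complex_of_real ((A *\<^sub>T B) ! k $$ (a, b)))"
      using ab carrier_tensorD[OF P p] by (simp add: dft_slice_def Let_def root_unity_def)
    also have "\<dots> = (\<Sum>k<p. \<Sum>r<p. \<Sum>c<n. (?w ^ (l * k) * complex_of_real (A ! ((k + p - r) mod p) $$ (a, c)))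
        * complex_of_real (B ! r $$ (c, b)))"
      using ab by (intro sum.cong refl) (simp add: t_prod_index[OF B] sum_distrib_left mult_ac)
    also have "\<dots> = (\<Sum>r<p. \<Sum>c<n. \<Sum>k<p. (?w ^ (l * k) * complex_of_real (A ! ((k + p - r) mod p) $$ (a, c)))
        * complex_of_real (B ! r $$ (c, b)))"
      by (subst sum.swap, rule sum.cong[OF refl], rule sum.swap)
    also have "\<dots> = (\<Sum>r<p. \<Sum>c<n. dft_slice A l $$ (a, c) * (?w ^ (l * r) * complex_of_real (B ! r $$ (c, b))))"
      by (intro sum.cong refl) (subst sum_distrib_right[symmetric], subst shift, simp_all add: mult_ac)
    also have "\<dots> = (\<Sum>c<n. dft_slice A l $$ (a, c) * (\<Sum>r<p. ?w ^ (l * r) * complex_of_real (B ! r $$ (c, b))))"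
      by (subst sum.swap) (simp add: sum_distrib_left)
    also have "\<dots> = (\<Sum>c<n. dft_slice A l $$ (a, c) * dft_slice B l $$ (c, b))"
      using ab carrier_tensorD[OF B p]
      by (intro sum.cong refl) (simp add: dft_slice_def Let_def root_unity_def)
    also have "\<dots> = (dft_slice A l * dft_slice B l) $$ (a, b)"
      by (rule index_mult_sum[symmetric, OF dft_slice_carrier dB ab])
    finally show "dft_slice (A *\<^sub>T B) l $$ (a, b) = (dft_slice A l * dft_slice B l) $$ (a, b)" .
  qed (use dP dB carrier_matD[OF dft_slice_carrier] in auto)
qed

lemma t_minus_carrier:
  assumes B: "B \<in> carrier_tensor m n p"
  shows "t_minus A B \<in> carrier_tensor m n p"
  using carrier_tensorD(1,4)[OF A p] carrier_tensorD(1,4)[OF B p]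
  by (auto simp: carrier_tensor_def t_minus_def set_zip intro: minus_carrier_mat)

lemma t_minus_index:
  assumes B: "B \<in> carrier_tensor m n p" and "i < m" "j < n" "k < p"
  shows "t_minus A B ! k $$ (i, j) = A ! k $$ (i, j) - B ! k $$ (i, j)"
  using assms carrier_tensorD(1)[OF A p] carrier_tensorD(1)[OF B p]
    carrier_matD[OF carrier_tensorD(4)[OF B p \<open>k < p\<close>]]
  by (simp add: t_minus_def)

lemma KM_S_carrier: "KM_S A \<in> carrier_tensor m n p"
  using carrier_tensorD[OF A p] by (auto simp: carrier_tensor_def KM_S_def)

lemma KM_S_index:
  assumes "i < m" "j < n" "k < p"
  shows "complex_of_real (KM_S A ! k $$ (i, j)) = (if i = j then 1 / of_nat p *
    (\<Sum>l<p. cnj (root_unity p) ^ (k * l) * complex_of_real (singular_values (dft_slice A l) ! i)) else 0)"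
proof -
  have "complex_of_real (Re (KM_coeff A i k)) = KM_coeff A i k"
    using KM_coeff_real by (rule of_real_Re)
  moreover have "KM_S A ! k $$ (i, j) = (if i = j then Re (KM_coeff A i k) else 0)"
    using carrier_tensorD[OF A p] assms by (simp add: KM_S_def)
  moreover have kc: "KM_coeff A i k = 1 / of_nat p *
      (\<Sum>l<p. cnj (root_unity p) ^ (k * l) * complex_of_real (singular_values (dft_slice A l) ! i))"
    using carrier_tensorD(1)[OF A p] by (simp add: KM_coeff_def Let_def root_unity_def)
  ultimately show ?thesis unfolding kc[symmetric] by (cases "i = j") simp_all
qed

end

lemma dft_minus:
  assumes A: "A \<in> carrier_tensor m n p" and B: "B \<in> carrier_tensor m n p" and p: "0 < p"
  shows "dft_slice (t_minus A B) l = dft_slice A l - dft_slice B l"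
proof (rule eq_matI)
  note c = dft_slice_carrier[OF A p] dft_slice_carrier[OF B p]
    dft_slice_carrier[OF t_minus_carrier[OF A p B] p]
  fix i j assume "i < dim_row (dft_slice A l - dft_slice B l)" "j < dim_col (dft_slice A l - dft_slice B l)"
  then have ij: "i < m" "j < n" using c(2)[of l] by auto
  then show "dft_slice (t_minus A B) l $$ (i, j) = (dft_slice A l - dft_slice B l) $$ (i, j)"
    using c(2)[of l] dft_slice_index[OF t_minus_carrier[OF A p B] p ij]
    by (simp add: dft_slice_index[OF A p] dft_slice_index[OF B p] t_minus_index[OF A p B]
      right_diff_distrib sum_subtractf)
qed (use dft_slice_carrier[OF B p, of l] dft_slice_carrier[OF t_minus_carrier[OF A p B] p, of l] in auto)

lemma dft_id:
  assumes p: "0 < p"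
  shows "dft_slice (t_id n p) l = 1\<^sub>m n"
proof (rule eq_matI)
  note I = bcirc_t_id[OF p, of n]
  fix i j assume "i < dim_row (1\<^sub>m n :: complex mat)" "j < dim_col (1\<^sub>m n :: complex mat)"
  then have ij: "i < n" "j < n" by auto
  have ent: "t_id n p ! k $$ (i, j) = (if k = 0 then if i = j then 1 else 0 else 0)" if k: "k < p" for k
  proof -
    have "t_id n p ! k $$ (i, j) = bcirc (t_id n p) $$ (k * n + i, 0 * n + j)"
      using bcirc_block[OF I(2) ij k p] k by simp
    also have "\<dots> = (if k * n + i = j then 1 else 0)"
      unfolding I(1) using block_index[of i n k p] block_index[of j n 0 p] ij k p by simp
    also have "(k * n + i = j) = (k = 0 \<and> i = j)" using ij by (cases k) auto
    finally show ?thesis by auto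
  qed
  have "dft_slice (t_id n p) l $$ (i, j) =
      (\<Sum>k<p. if k = 0 then if i = j then 1 else 0 else 0)"
    unfolding dft_slice_index[OF I(2) p ij] by (intro sum.cong refl) (simp add: ent)
  then show "dft_slice (t_id n p) l $$ (i, j) = 1\<^sub>m n $$ (i, j)" using p ij by simp
qed (use dft_slice_carrier[OF bcirc_t_id(2)[OF p] p, of n l] in auto)

lemma unitary_dft:
  assumes Q: "t_orthogonal n p Q" and p: "0 < p"
  shows "unitary_mat n (dft_slice Q l)"
proof -
  have c: "Q \<in> carrier_tensor n n p" and o: "Q *\<^sub>T t_transpose Q = t_id n p" "t_transpose Q *\<^sub>T Q = t_id n p"
    using Q by (auto simp: t_orthogonal_def)
  have T: "t_transpose Q \<in> carrier_tensor n n p" by (rule bcirc_t_transpose[OF p c])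
  show ?thesis
    using dft_prod[OF c p T, of l] dft_prod[OF T p c, of l]
    by (simp add: unitary_mat_def o dft_id[OF p] dft_transpose[OF c p] dft_slice_carrier[OF c p])
qed

text \<open>
  The tensor \<open>KM_S A\<close> is defined by an inverse Fourier transform; undoing it leaves the diagonal
  matrices of the singular values.
\<close>

lemma dft_KM_S:
  assumes A: "A \<in> carrier_tensor m n p" and p: "0 < p" and l: "l < p" and ij: "i < m" "j < n"
  shows "dft_slice (KM_S A) l $$ (i, j) =
    (if i = j then complex_of_real (singular_values (dft_slice A l) ! i) else 0)"
proof -
  let ?L = "\<lambda>l. complex_of_real (singular_values (dft_slice A l) ! i)"
  have "dft_slice (KM_S A) l $$ (i, j) = (\<Sum>k<p. root_unity p ^ (l * k) *
      (if i = j then 1 / of_nat p * (\<Sum>l<p. cnj (root_unity p) ^ (k * l) * ?L l) else 0))"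
    unfolding dft_slice_index[OF KM_S_carrier[OF A p] p ij]
    by (rule sum.cong[OF refl]) (simp only: KM_S_index[OF A p ij] lessThan_iff)
  then show ?thesis using dft_inverse[OF l, of ?L] by (cases "i = j") simp_all
qed

section \<open>Truncation and T-rank one\<close>

lemma unitary_mat_adjoint: "unitary_mat n U \<Longrightarrow> unitary_mat n (mat_adjoint U)"
  by (simp add: unitary_mat_def)

lemma keep_diag_carrier:
  assumes S: "S \<in> carrier_tensor m n p" and p: "0 < p"
  shows "keep_diag S x \<in> carrier_tensor m n p"
  using carrier_tensorD[OF S p] by (auto simp: carrier_tensor_def keep_diag_def)

lemma keep_diag_index:
  assumes S: "S \<in> carrier_tensor m n p" and "k < p" "a < m" "b < n"
  shows "keep_diag S (i0, k0) ! k $$ (a, b) = (if k = k0 then if a = i0 \<and> b = i0 then S ! k0 $$ (i0, i0) else 0 else 0)"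
proof -
  have "0 < p" using assms by simp
  then show ?thesis using carrier_tensorD[OF S] assms by (auto simp: keep_diag_def)
qed

lemma dft_keep_diag:
  assumes S: "S \<in> carrier_tensor m n p" and k0: "k0 < p" and ab: "a < m" "b < n"
  shows "dft_slice (keep_diag S (i0, k0)) l $$ (a, b) =
    (if a = i0 \<and> b = i0 then root_unity p ^ (l * k0) * complex_of_real (S ! k0 $$ (i0, i0)) else 0)"
proof -
  have p: "0 < p" using k0 by simp
  have "dft_slice (keep_diag S (i0, k0)) l $$ (a, b) = (\<Sum>k<p. if k = k0 then
      if a = i0 \<and> b = i0 then root_unity p ^ (l * k0) * complex_of_real (S ! k0 $$ (i0, i0)) else 0 else 0)"
    unfolding dft_slice_index[OF keep_diag_carrier[OF S p] p ab]
    by (intro sum.cong refl) (simp add: keep_diag_index[OF S _ ab])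
  then show ?thesis using k0 by simp
qed

lemma frob_norm_minus_keep_diag:
  assumes S: "S \<in> carrier_tensor m n p" and x: "i0 < m" "i0 < n" "k0 < p"
  shows "(frob_norm (t_minus S (keep_diag S (i0, k0))))\<^sup>2 = (frob_norm S)\<^sup>2 - (S ! k0 $$ (i0, i0))\<^sup>2"
proof -
  have p: "0 < p" using x by simp
  note K = keep_diag_carrier[OF S p]
  let ?c = "(S ! k0 $$ (i0, i0))\<^sup>2"
  have "(frob_norm (t_minus S (keep_diag S (i0, k0))))\<^sup>2 = (\<Sum>k<p. \<Sum>a<m. \<Sum>b<n.
      (S ! k $$ (a, b))\<^sup>2 - (if b = i0 then if a = i0 then if k = k0 then ?c else 0 else 0 else 0))"
    unfolding frob_norm_power2[OF t_minus_carrier[OF S p K] p]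
    by (intro sum.cong refl) (auto simp: t_minus_index[OF S p K] keep_diag_index[OF S])
  also have "\<dots> = (frob_norm S)\<^sup>2 - ?c"
    using x by (simp add: sum_subtractf frob_norm_power2[OF S p])
  finally show ?thesis .
qed

lemma KM_S_of_constant_singular_values:
  assumes A: "A \<in> carrier_tensor m n p" and p: "0 < p" and i: "i < min m n" and k: "k < p"
    and const: "\<And>l. l < p \<Longrightarrow> singular_values (dft_slice A l) ! i = s"
  shows "KM_S A ! k $$ (i, i) = (if k = 0 then s else 0)"
proof -
  have "complex_of_real (KM_S A ! k $$ (i, i)) = 1 / of_nat p *
      (\<Sum>l<p. cnj (root_unity p) ^ (k * l) * complex_of_real s)"
    using i k const by (simp add: KM_S_index[OF A p])
  also have "(\<Sum>l<p. cnj (root_unity p) ^ (k * l) * complex_of_real s) =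
      complex_of_real s * (\<Sum>l<p. root_unity p ^ (l * 0) * cnj (root_unity p) ^ (l * k))"
    by (simp add: sum_distrib_left mult.commute)
  also have "\<dots> = complex_of_real s * (if k = 0 then of_nat p else 0)"
    using root_unity_orthogonal[OF p k] by simp
  finally have "complex_of_real (KM_S A ! k $$ (i, i)) = complex_of_real (if k = 0 then s else 0)"
    using p by (simp split: if_splits)
  then show ?thesis by (simp only: of_real_eq_iff)
qed

text \<open>
  The leading diagonal entry of \<open>KM_S A\<close> is the mean of the largest singular values of the
  Fourier slices. This is how the bound on a competitor of T-rank one comes to involve an entry
  of \<open>KM_S A\<close>.
\<close>

lemma KM_S_leading_entry:
  assumes A: "A \<in> carrier_tensor m n p" and "0 < m" "0 < n" "0 < p"
  shows "real p * KM_S A ! 0 $$ (0, 0) = (\<Sum>l<p. singular_values (dft_slice A l) ! 0)"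
proof -
  have "complex_of_real (real p * KM_S A ! 0 $$ (0, 0)) = complex_of_real (\<Sum>l<p. singular_values (dft_slice A l) ! 0)"
    using assms by (simp add: KM_S_index[OF A])
  then show ?thesis by (simp only: of_real_eq_iff)
qed

text \<open>
  If a single singular value \<open>s\<close>, the same in all Fourier slices, is nonzero, then the inverse
  Fourier transform concentrates it at the position \<open>(0, 0)\<close>.
\<close>

lemma T_rank_le_1I:
  assumes X: "X \<in> carrier_tensor m n p" and p: "0 < p"
    and sv: "\<And>l. l < p \<Longrightarrow> singular_values (dft_slice X l) = s # replicate (n - 1) 0"
  shows "T_rank X \<le> 1"
proof -
  have "{y \<in> diag_positions X. t_singular_value X y \<noteq> 0} \<subseteq> {(0, 0)}"
  proof
    fix y assume y: "y \<in> {y \<in> diag_positions X. t_singular_value X y \<noteq> 0}"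
    obtain i k where ik: "y = (i, k)" by (cases y)
    have i: "i < min m n" and k: "k < p" and nz: "KM_S X ! k $$ (i, i) \<noteq> 0"
      using y carrier_tensorD[OF X p] by (auto simp: ik diag_positions_def t_singular_value_def)
    have "KM_S X ! k $$ (i, i) = (if k = 0 then if i = 0 then s else 0 else 0)"
      using i by (intro KM_S_of_constant_singular_values[OF X p i k, THEN trans]) (auto simp: sv nth_Cons split: nat.splits)
    then show "y \<in> {(0, 0)}" using nz ik by (auto split: if_splits)
  qed
  from card_mono[OF _ this] show ?thesis by (simp add: T_rank_def)
qed

text \<open>
  Let \<open>(i0, k0)\<close> be a position outside which \<open>S = KM_S B\<close> has no nonzero diagonal entry. The
  \<open>i\<close>-th singular value of the Fourier slice \<open>l\<close> is \<open>\<Sum>\<^sub>k \<omega>\<^sup>l\<^sup>k S(i, i, k)\<close>. This sum is zero for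
  \<open>i \<noteq> i0\<close>; as singular values are nonnegative and non-increasing in \<open>i\<close>, it is zero for all \<open>i >
  0\<close>. For \<open>i = 0\<close> only one summand is left, whose modulus does not depend on \<open>l\<close>.
\<close>

lemma T_rank_le_1D:
  assumes B: "B \<in> carrier_tensor m n p" and pos: "0 < m" "0 < n" "0 < p" and r: "T_rank B \<le> 1"
  obtains s where "\<And>l. l < p \<Longrightarrow> singular_values (dft_slice B l) ! 0 = s"
    and "\<And>l. l < p \<Longrightarrow> frobenius_sq (dft_slice B l) = s\<^sup>2"
proof -
  note p = pos(3)
  let ?L = "\<lambda>i l. singular_values (dft_slice B l) ! i"
  let ?P = "{y \<in> diag_positions B. t_singular_value B y \<noteq> 0}"
  have "finite (diag_positions B)" by (simp add: diag_positions_def)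
  then have "finite ?P" by simp
  then have eq: "\<forall>y\<in>?P. \<forall>z\<in>?P. y = z"
    using r unfolding T_rank_def by (simp only: One_nat_def card_le_Suc0_iff_eq)
  have "\<exists>y. ?P \<subseteq> {y}"
  proof (cases "?P = {}")
    case False
    then obtain y where "y \<in> ?P" by blast
    with eq have "?P \<subseteq> {y}" by blast
    then show ?thesis by blast
  qed blast
  then obtain y where sub: "?P \<subseteq> {y}" by blast
  obtain i0 k0 where y: "y = (i0, k0)" by (cases y)
  note sub = sub[unfolded y]
  have zero: "KM_S B ! k $$ (i, i) = 0" if "i < min m n" "k < p" "(i, k) \<noteq> (i0, k0)" for i k
  proof -
    have "(i, k) \<notin> ?P" using that(3) sub by blast
    moreover have "(i, k) \<in> diag_positions B"
      using that carrier_tensorD[OF B p] by (simp add: diag_positions_def)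
    ultimately show ?thesis by (simp add: t_singular_value_def)
  qed
  have L: "complex_of_real (?L i l) = (\<Sum>k<p. root_unity p ^ (l * k) * complex_of_real (KM_S B ! k $$ (i, i)))"
    if "l < p" "i < min m n" for i l
    using dft_KM_S[OF B p that(1), of i i] dft_slice_index[OF KM_S_carrier[OF B p] p, of i i l] that by simp
  have Lz: "?L i l = 0" if "i < min m n" "i \<noteq> i0" "l < p" for i l
    using L[OF that(3,1)] zero[OF that(1)] that(2) by simp
  have nn: "0 \<le> ?L i l" if "i < n" for i l
    using that length_singular_values[OF dft_slice_carrier[OF B p]]
    by (intro singular_values_nonneg[of _ "dft_slice B l"]) simp
  have tail: "?L i l = 0" if i: "0 < i" "i < min m n" and l: "l < p" for i l
  proof (cases "i = i0")
    case True
    then have "?L 0 l = 0" using i l pos by (intro Lz) auto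
    then show ?thesis
      using singular_values_antimono[OF dft_slice_carrier[OF B p], of 0 i l] nn[of i l] i by simp
  qed (use Lz i l in simp)
  define s where "s = (if k0 < p then \<bar>KM_S B ! k0 $$ (0, 0)\<bar> else 0) * (if i0 = 0 then 1 else 0)"
  have min0: "0 < min m n" using pos by simp
  have head: "?L 0 l = s" if l: "l < p" for l
  proof -
    have "complex_of_real (?L 0 l) = (\<Sum>k<p. if k = k0 then if i0 = 0 then
        root_unity p ^ (l * k0) * complex_of_real (KM_S B ! k0 $$ (0, 0)) else 0 else 0)"
      unfolding L[OF l min0] by (rule sum.cong[OF refl]) (use zero[OF min0] in auto)
    also have "\<dots> = (if k0 < p then if i0 = 0 then
        root_unity p ^ (l * k0) * complex_of_real (KM_S B ! k0 $$ (0, 0)) else 0 else 0)"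
      by simp
    finally have "cmod (complex_of_real (?L 0 l)) = s"
      by (auto simp: s_def norm_mult norm_power root_unity_def)
    then show ?thesis using nn[OF pos(2), of l] by simp
  qed
  show thesis
  proof (rule that)
    show "?L 0 l = s" if "l < p" for l by (rule head[OF that])
    show "frobenius_sq (dft_slice B l) = s\<^sup>2" if "l < p" for l
      using frobenius_sq_eq_sq_singular_value[OF dft_slice_carrier[OF B p] pos(2,1) tail] head that by metis
  qed
qed

section \<open>The best T-rank one approximation\<close>

theorem theorem5p2:
  fixes m n p :: nat and A U V :: tensor and x :: "nat \<times> nat"
  assumes "0 < m" and "0 < n" and "0 < p"
    and "A \<in> carrier_tensor m n p"
    and "is_KM_TSVD A U V"
    and "x \<in> diag_positions A" and "t_singular_value A x = \<sigma>\<^sub>1 A"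
  defines "A\<^sub>1 \<equiv> U *\<^sub>T keep_diag (KM_S A) x *\<^sub>T t_transpose V"
  shows "T_rank A\<^sub>1 \<le> 1 \<and>
    (\<forall>B \<in> carrier_tensor m n p. T_rank B \<le> 1 \<longrightarrow>
       frob_norm (t_minus A A\<^sub>1) \<le> frob_norm (t_minus A B))"
proof -
  note pos = \<open>0 < m\<close> \<open>0 < n\<close> \<open>0 < p\<close> and p = \<open>0 < p\<close> and A = \<open>A \<in> carrier_tensor m n p\<close>
  note DA = carrier_tensorD[OF A p]
  obtain i0 k0 where x: "x = (i0, k0)" by (cases x)
  have i0: "i0 < m" "i0 < n" and k0: "k0 < p"
    using \<open>x \<in> diag_positions A\<close> DA by (auto simp: x diag_positions_def)
  define S where "S = KM_S A"
  define S1 where "S1 = keep_diag S x"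
  have S: "S \<in> carrier_tensor m n p" unfolding S_def by (rule KM_S_carrier[OF A p])
  have S1: "S1 \<in> carrier_tensor m n p" unfolding S1_def by (rule keep_diag_carrier[OF S p])
  have oU: "t_orthogonal m p U" and oV: "t_orthogonal n p V" and fac: "A = U *\<^sub>T S *\<^sub>T t_transpose V"
    using \<open>is_KM_TSVD A U V\<close> DA by (simp_all add: is_KM_TSVD_def S_def)
  have U: "U \<in> carrier_tensor m m p" and V: "V \<in> carrier_tensor n n p"
    using oU oV by (simp_all add: t_orthogonal_def)
  note VT = bcirc_t_transpose(2)[OF p V]
  have dft_fac: "dft_slice (U *\<^sub>T X *\<^sub>T t_transpose V) l
      = dft_slice U l * dft_slice X l * mat_adjoint (dft_slice V l)"
    if X: "X \<in> carrier_tensor m n p" for X l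
    by (simp add: dft_prod[OF bcirc_t_prod(2)[OF p U X] p VT] dft_prod[OF U p X] dft_transpose[OF V p])
  have A1: "A\<^sub>1 \<in> carrier_tensor m n p"
    unfolding A\<^sub>1_def S_def[symmetric] S1_def[symmetric]
    by (rule bcirc_t_prod(2)[OF p bcirc_t_prod(2)[OF p U S1] VT])
  have dA: "dft_slice A l = dft_slice U l * dft_slice S l * mat_adjoint (dft_slice V l)" for l
    by (subst fac) (rule dft_fac[OF S])
  have dA1: "dft_slice A\<^sub>1 l = dft_slice U l * dft_slice S1 l * mat_adjoint (dft_slice V l)" for l
    unfolding A\<^sub>1_def S_def[symmetric] S1_def[symmetric] by (rule dft_fac[OF S1])
  have u: "unitary_mat m (dft_slice U l)" and v: "unitary_mat n (dft_slice V l)" for l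
    using unitary_dft[OF oU p] unitary_dft[OF oV p] by auto
  note cU = dft_slice_carrier[OF U p] and cV = dft_slice_carrier[OF V p]
    and cS = dft_slice_carrier[OF S p] and cS1 = dft_slice_carrier[OF S1 p]
  have frobenius_sq_diff: "frobenius_sq (dft_slice U l * M * mat_adjoint (dft_slice V l) - dft_slice U l * N * mat_adjoint (dft_slice V l))
      = frobenius_sq (M - N)" if M: "M \<in> carrier_mat m n" and N: "N \<in> carrier_mat m n" for M N l
  proof -
    have "dft_slice U l * (M - N) * mat_adjoint (dft_slice V l)
        = dft_slice U l * M * mat_adjoint (dft_slice V l) - dft_slice U l * N * mat_adjoint (dft_slice V l)"
      using minus_mult_distrib_mat[OF mult_carrier_mat[OF cU M] mult_carrier_mat[OF cU N] mat_adjoint_carrier[OF cV]]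
        mult_minus_distrib_mat[OF cU M N] by simp
    then show ?thesis using frobenius_sq_unitary[OF u v minus_carrier_mat[OF N]] by metis
  qed

  have "T_rank A\<^sub>1 \<le> 1"
  proof (rule T_rank_le_1I[OF A1 p])
    fix l assume "l < p"
    have "singular_values (dft_slice A\<^sub>1 l) = singular_values (dft_slice S1 l)"
      unfolding dA1 by (rule singular_values_unitary[OF u v cS1])
    also have "\<dots> = cmod (root_unity p ^ (l * k0) * complex_of_real (S ! k0 $$ (i0, i0))) # replicate (n - 1) 0"
      unfolding S1_def x by (intro singular_values_single_entry[OF _ i0] dft_keep_diag[OF S k0])
        (use cS1 S1_def x in auto)
    finally show "singular_values (dft_slice A\<^sub>1 l) = \<bar>S ! k0 $$ (i0, i0)\<bar> # replicate (n - 1) 0"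
      by (simp add: norm_mult norm_power root_unity_def)
  qed
  moreover have "frob_norm (t_minus A A\<^sub>1) \<le> frob_norm (t_minus A B)"
    if B: "B \<in> carrier_tensor m n p" and rB: "T_rank B \<le> 1" for B
  proof -
    have "real p * (frob_norm (t_minus A A\<^sub>1))\<^sup>2 = (\<Sum>l<p. frobenius_sq (dft_slice A l - dft_slice A\<^sub>1 l))"
      by (simp add: frob_norm_dft[OF t_minus_carrier[OF A p A1] p, symmetric] dft_minus[OF A A1 p])
    also have "\<dots> = (\<Sum>l<p. frobenius_sq (dft_slice S l - dft_slice S1 l))"
      unfolding dA dA1 by (simp add: frobenius_sq_diff[OF cS cS1])
    also have "\<dots> = real p * (frob_norm (t_minus S S1))\<^sup>2"
      by (simp add: frob_norm_dft[OF t_minus_carrier[OF S p S1] p, symmetric] dft_minus[OF S S1 p])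
    finally have left: "(frob_norm (t_minus A A\<^sub>1))\<^sup>2 = (frob_norm S)\<^sup>2 - (S ! k0 $$ (i0, i0))\<^sup>2"
      using p frob_norm_minus_keep_diag[OF S i0 k0] by (simp add: S1_def x)

    \<comment> \<open>The leading entry is what bounds the inner product of \<open>A\<close> and \<open>B\<close>; it is dominated by \<open>\<sigma>\<^sub>1\<close>.\<close>
    let ?t = "S ! 0 $$ (0, 0)" and ?\<sigma> = "\<lambda>l. singular_values (dft_slice A l) ! 0"
    have "t_singular_value A (0, 0) \<le> \<sigma>\<^sub>1 A"
      unfolding \<sigma>\<^sub>1_def using DA pos by (intro Max_ge) (auto simp: diag_positions_def)
    then have "\<bar>?t\<bar> \<le> \<bar>S ! k0 $$ (i0, i0)\<bar>"
      using \<open>t_singular_value A x = \<sigma>\<^sub>1 A\<close> by (simp add: t_singular_value_def x S_def)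
    then have t: "?t\<^sup>2 \<le> (S ! k0 $$ (i0, i0))\<^sup>2" by (simp add: abs_le_square_iff)

    \<comment> \<open>In the Fourier domain the competitor is a family of rank one matrices of one and the same norm.\<close>
    obtain s where s: "\<And>l. l < p \<Longrightarrow> singular_values (dft_slice B l) ! 0 = s"
      "\<And>l. l < p \<Longrightarrow> frobenius_sq (dft_slice B l) = s\<^sup>2"
      using T_rank_le_1D[OF B pos rB] by blast
    have slice: "frobenius_sq (dft_slice S l) - 2 * ?\<sigma> l * s + s\<^sup>2 \<le> frobenius_sq (dft_slice A l - dft_slice B l)"
      if l: "l < p" for l
    proof -
      \<comment> \<open>In the singular bases of \<open>A\<close> the slice of \<open>A\<close> becomes diagonal and that of \<open>B\<close> becomes \<open>M\<close>.\<close>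
      define M where "M = mat_adjoint (dft_slice U l) * dft_slice B l * mat_adjoint (mat_adjoint (dft_slice V l))"
      note cB = dft_slice_carrier[OF B p, of l]
      have M: "M \<in> carrier_mat m n"
        unfolding M_def mat_adjoint_adjoint
        by (rule mult_carrier_mat[OF mult_carrier_mat[OF mat_adjoint_carrier[OF cU] cB] cV])
      have uv: "unitary_mat m (mat_adjoint (dft_slice U l))" "unitary_mat n (mat_adjoint (dft_slice V l))"
        using u v by (auto intro: unitary_mat_adjoint)
      have svM: "singular_values M ! 0 = s" "frobenius_sq M = s\<^sup>2"
        unfolding M_def using s[OF l] singular_values_unitary[OF uv cB] frobenius_sq_unitary[OF uv cB] by simp_all
      have "dft_slice U l * M * mat_adjoint (dft_slice V l)
          = (dft_slice U l * mat_adjoint (dft_slice U l)) * dft_slice B l * (dft_slice V l * mat_adjoint (dft_slice V l))"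
        unfolding M_def mat_adjoint_adjoint using cU[of l] cV[of l] cB
        by (smt (verit) assoc_mult_mat mult_carrier_mat mat_adjoint_carrier)
      also have "\<dots> = dft_slice B l" using u[of l] v[of l] cB by (simp add: unitary_mat_def)
      finally have "frobenius_sq (dft_slice A l - dft_slice B l) = frobenius_sq (dft_slice S l - M)"
        using frobenius_sq_diff[OF cS M] dA by metis
      moreover have "frobenius_sq (dft_slice S l) - 2 * ?\<sigma> l * singular_values M ! 0 + (singular_values M ! 0)\<^sup>2
          \<le> frobenius_sq (dft_slice S l - M)"
      proof (rule frobenius_sq_diag_minus_rank_one[OF cS M \<open>0 < n\<close>])
        show "dft_slice S l $$ (i, j) = 0" if "i < m" "j < n" "i \<noteq> j" for i j
          using that by (simp add: S_def dft_KM_S[OF A p l])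
        show "cmod (dft_slice S l $$ (i, i)) \<le> ?\<sigma> l" if i: "i < min m n" for i
        proof -
          have "0 \<le> singular_values (dft_slice A l) ! i"
            using i length_singular_values[OF dft_slice_carrier[OF A p]]
            by (intro singular_values_nonneg[of _ "dft_slice A l"]) simp
          then show ?thesis
            using i singular_values_antimono[OF dft_slice_carrier[OF A p], of 0 i l]
            by (simp add: S_def dft_KM_S[OF A p l])
        qed
      qed (simp add: svM)
      ultimately show ?thesis by (simp add: svM)
    qed
    have "real p * ((frob_norm S)\<^sup>2 - 2 * ?t * s + s\<^sup>2)
        = (\<Sum>l<p. frobenius_sq (dft_slice S l) - 2 * ?\<sigma> l * s + s\<^sup>2)"
      using KM_S_leading_entry[OF A pos] frob_norm_dft[OF S p]
      by (simp add: S_def[symmetric] sum.distrib sum_subtractf sum_distrib_right[symmetric]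
        sum_distrib_left[symmetric] algebra_simps)
    also have "\<dots> \<le> (\<Sum>l<p. frobenius_sq (dft_slice A l - dft_slice B l))"
      using slice by (intro sum_mono) simp
    also have "\<dots> = real p * (frob_norm (t_minus A B))\<^sup>2"
      by (simp add: frob_norm_dft[OF t_minus_carrier[OF A p B] p, symmetric] dft_minus[OF A B p])
    finally have right: "(frob_norm S)\<^sup>2 - 2 * ?t * s + s\<^sup>2 \<le> (frob_norm (t_minus A B))\<^sup>2"
      using p by simp
    \<comment> \<open>Minimize over the norm \<open>s\<close> of the competitor; the minimum is attained at \<open>s = ?t\<close>.\<close>
    have "0 \<le> (s - ?t)\<^sup>2" by simp
    then have "(frob_norm S)\<^sup>2 - ?t\<^sup>2 \<le> (frob_norm S)\<^sup>2 - 2 * ?t * s + s\<^sup>2"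
      by (simp add: power2_eq_square algebra_simps)
    with left right t have "(frob_norm (t_minus A A\<^sub>1))\<^sup>2 \<le> (frob_norm (t_minus A B))\<^sup>2" by linarith
    then show ?thesis by (rule power2_le_imp_le) (simp add: frob_norm_def sum_nonneg)
  qed
  ultimately show ?thesis by blast
qed

end
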